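(* Let $N\in\mathbb{N}\setminus\{0,1\}$, $p\in[1,\infty)$ and $u\in C^1_c(\overline{\mathbb{R}}^N_+)$. Then $$\lim_{s\to1^-}(1-s)\int_{\partial\mathbb{R}^N_+}\Bigl(\int_{\mathbb{R}^N_+}\frac{|u(x)-u(y)|^p}{|x-y|^{N+sp}}\,\mathrm{d}y\Bigr)\mathrm{d}x=\frac{\pi^{\frac{N-1}{2}}\,\Gamma\bigl(\frac{p+1}{2}\bigr)}{p\,\Gamma\bigl(\frac{N+p}{2}\bigr)}\int_{\partial\mathbb{R}^N_+}|\mathrm{D}u|^p .$$
   Context: $\mathbb{R}^N_+ = \mathbb{R}^{N-1}\times(0,\infty)$ and $\overline{\mathbb{R}}^N_+=\mathbb{R}^{N-1}\times[0,\infty)$. The boundary $\partial\mathbb{R}^N_+ = \mathbb{R}^{N-1}\times\{0\}$ is identified with $\mathbb{R}^{N-1}$ and carries the $(N-1)$-dimensional Lebesgue measure. $C^1_c(\overline{\mathbb{R}}^N_+)$ is the set of real-valued functions that are continuously differentiable up to the boundary on $\overline{\mathbb{R}}^N_+$ and have compact support in $\overline{\mathbb{R}}^N_+$ (they need not vanish on the boundary). $\mathrm{D}u$ is the full derivative in $\mathbb{R}^N$ (both tangential and normal components), $|\mathrm{D}u|$ is its Euclidean norm, and $\Gamma$ is the Euler Gamma function. *)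

theory Defs
  imports "HOL-Analysis.Analysis"
begin

text \<open>
  The space \<open>\<real>\<^sup>N\<close> is \<open>(real ^ 'n) \<times> real\<close> with \<open>N = CARD('n) + 1\<close>; the second component is
  the last coordinate. The norm of the product type is the Euclidean norm and \<open>lborel\<close> is
  \<open>N\<close>-dimensional Lebesgue measure. As \<open>CARD('n) \<ge> 1\<close>, exactly the dimensions \<open>N \<ge> 2\<close> occur.
  The boundary point corresponding to \<open>x :: real ^ 'n\<close> is \<open>(x, 0)\<close>.
\<close>

definition open_half_space :: "((real ^ 'n) \<times> real) set" where
  "open_half_space = UNIV \<times> {0<..}"

definition closed_half_space :: "((real ^ 'n) \<times> real) set" where
  "closed_half_space = UNIV \<times> {0..}"

text \<open>
  Functions on the closed half-space are total functions of which only the values on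
  \<open>closed_half_space\<close> matter; derivatives are therefore taken within that set, where they are
  unique, also at boundary points. The gradient below comprises the tangential and the normal
  partial derivatives.
\<close>

definition half_space_gradient ::
    "((real ^ 'n) \<times> real \<Rightarrow> real) \<Rightarrow> (real ^ 'n) \<times> real \<Rightarrow> (real ^ 'n) \<times> real" where
  "half_space_gradient u x =
     (\<Sum>b\<in>Basis. frechet_derivative u (at x within closed_half_space) b *\<^sub>R b)"

definition C1c_closed_half_space :: "((real ^ 'n) \<times> real \<Rightarrow> real) set" where
  "C1c_closed_half_space =
     {u. u differentiable_on closed_half_space \<and>
         continuous_on closed_half_space (half_space_gradient u) \<and>
         compact (closure {x \<in> closed_half_space. u x \<noteq> 0})}"

end

theory Submission
  imports Defs "HOL-Probability.Distributions"
begin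

text \<open>
  Write \<open>y = (x, 0) + h\<close> with \<open>h\<close> in the half-space. For small \<open>h\<close> the numerator is close to
  \<open>\<bar>Du(x, 0) \<bullet> h\<bar>\<^sup>p\<close>, and \<open>Du\<close> is uniformly continuous, so it is natural to split the kernel as
  \<open>\<bar>u(x, 0) - u(y)\<bar>\<^sup>p / \<bar>h\<bar>\<^sup>p\<close> times \<open>\<bar>h\<bar>\<close> to the power \<open>(1 - s) p - N\<close>.
  After the exchange of the two integrations (\<open>seminorm_eq_weighted_integral\<close>) the first factor is averaged over \<open>x\<close>, and a single function of
  \<open>h\<close> is left, the \<open>difference_average\<close>. As \<open>h\<close> tends to 0 it differs by less and less from the
  \<open>slope_average\<close>, in which \<open>\<bar>Du(x, 0) \<bullet> h\<bar> / \<bar>h\<bar>\<close> replaces the difference quotient and which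
  depends on the direction of \<open>h\<close> only. The averages are compared by means of bounds that are
  uniform in \<open>x\<close>, multiplied by the finite volume of the set of \<open>x\<close> to which the support of \<open>u\<close>
  contributes.

  The weight \<open>(1 - s) \<bar>h\<bar>\<close> to the power \<open>(1 - s) p - N\<close> is an approximate identity. In polar
  coordinates its mass on the ball of radius \<open>\<delta>\<close> is a constant times \<open>\<delta>\<close> to the power \<open>(1 - s) p\<close>,
  divided by \<open>p\<close>; this tends to the constant over \<open>p\<close> for each \<open>\<delta>\<close>, while the part
  outside the ball disappears because of the factor \<open>1 - s\<close>. Hence the limit is \<open>1 / p\<close> times the integral of the slope average
  over the unit half-sphere (\<open>concentration_at_zero\<close>).

  Integrals over the sphere are written as \<open>N\<close> times integrals over the unit ball, which agree for
  functions of the direction. What polar coordinates are used for is then a statement about Lebesgue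
  measure alone, \<open>nn_integral_homogeneous_times_radial\<close>.

  It remains to integrate \<open>(\<bar>v \<bullet> h\<bar> / \<bar>h\<bar>)\<^sup>p\<close> over a half-sphere
  (\<open>nn_integral_angular_half_space\<close>). The function is even, so this is half the integral over the
  sphere, and the latter is found by integrating \<open>\<bar>v \<bullet> h\<bar>\<^sup>p exp (- \<bar>h\<bar>\<^sup>2)\<close> over the space in two
  ways. In polar coordinates the radial factor is a value of \<open>\<Gamma>\<close>, the one in the denominator of the
  constant. On the other hand \<open>v \<bullet> h\<close> is, for a unit vector \<open>v\<close>, a normal random variable under the
  Gaussian measure, so that a one-dimensional integral is left, which gives the numerator.
\<close>

section \<open>Homogeneous functions against radial weights\<close>

lemma nn_integral_scaleR_ball:
  fixes \<phi> :: "'a::euclidean_space \<Rightarrow> ennreal"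
  assumes [measurable]: "\<phi> \<in> borel_measurable borel"
    and hom: "\<And>t h. 0 < t \<Longrightarrow> \<phi> (t *\<^sub>R h) = \<phi> h" and "0 < t"
  shows "(\<integral>\<^sup>+h. \<phi> h * indicator (ball 0 t) h \<partial>lborel)
       = ennreal (t ^ DIM('a)) * (\<integral>\<^sup>+h. \<phi> h * indicator (ball 0 1) h \<partial>lborel)"
proof -
  have [measurable]: "ball (0::'a) t \<in> sets borel" "ball (0::'a) 1 \<in> sets borel" by simp_all
  have "(\<integral>\<^sup>+h. \<phi> h * indicator (ball 0 t) h \<partial>lborel)
      = (\<integral>\<^sup>+h. \<phi> h * indicator (ball 0 t) h \<partial>density (distr lborel borel (\<lambda>x. 0 + t *\<^sub>R x)) (\<lambda>_. ennreal (\<bar>t\<bar> ^ DIM('a))))"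
    using \<open>0 < t\<close> by (subst lborel_affine[of t 0, symmetric]) auto
  also have "\<dots> = (\<integral>\<^sup>+h. ennreal (\<bar>t\<bar> ^ DIM('a)) * (\<phi> (0 + t *\<^sub>R h) * indicator (ball 0 t) (0 + t *\<^sub>R h)) \<partial>lborel)"
    by (subst nn_integral_density) (auto simp: nn_integral_distr)
  also have "\<dots> = (\<integral>\<^sup>+h. ennreal (t ^ DIM('a)) * (\<phi> h * indicator (ball 0 1) h) \<partial>lborel)"
    using \<open>0 < t\<close> by (intro nn_integral_cong) (auto simp: hom indicator_def mult_less_cancel_left2)
  also have "\<dots> = ennreal (t ^ DIM('a)) * (\<integral>\<^sup>+h. \<phi> h * indicator (ball 0 1) h \<partial>lborel)"
    by (subst nn_integral_cmult) auto
  finally show ?thesis .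
qed

text \<open>
  Integration in polar coordinates. \<open>DIM('a)\<close> times the integral of \<open>\<phi>\<close>
  over the unit ball takes the place of the integral over the sphere. The image of the measure
  \<open>\<phi> dh\<close> under the norm and the measure with density proportional to \<open>r\<close> to the power \<open>DIM('a) - 1\<close>
  give the same mass to each half-line below \<open>t\<close>, by scaling, and hence coincide.
\<close>

lemma nn_integral_homogeneous_times_radial:
  fixes \<phi> :: "'a::euclidean_space \<Rightarrow> ennreal" and \<psi> :: "real \<Rightarrow> ennreal"
  assumes [measurable]: "\<phi> \<in> borel_measurable borel" "\<psi> \<in> borel_measurable borel"
    and hom: "\<And>t h. 0 < t \<Longrightarrow> \<phi> (t *\<^sub>R h) = \<phi> h"
    and fin: "(\<integral>\<^sup>+h. \<phi> h * indicator (ball 0 1) h \<partial>lborel) < \<infinity>"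
  shows "(\<integral>\<^sup>+h. \<phi> h * \<psi> (norm h) \<partial>lborel)
       = ennreal DIM('a) * (\<integral>\<^sup>+h. \<phi> h * indicator (ball 0 1) h \<partial>lborel)
         * (\<integral>\<^sup>+r\<in>{0<..}. \<psi> r * ennreal (r ^ (DIM('a) - 1)) \<partial>lborel)"
proof -
  define m where "m = (\<integral>\<^sup>+h. \<phi> h * indicator (ball 0 1) h \<partial>lborel)"
  define w where "w = (\<lambda>r::real. ennreal DIM('a) * m * (ennreal (r ^ (DIM('a) - 1)) * indicator {0<..} r))"
  have w[measurable]: "w \<in> borel_measurable borel" unfolding w_def by measurable
  define \<mu> where "\<mu> = distr (density lborel \<phi>) borel norm"
  define \<nu> where "\<nu> = density lborel w"
  have \<mu>: "emeasure \<mu> {..<t} = (if 0 < t then ennreal (t ^ DIM('a)) * m else 0)" for t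
  proof -
    have "emeasure \<mu> {..<t} = (\<integral>\<^sup>+h. \<phi> h * indicator (ball 0 t) h \<partial>lborel)"
      unfolding \<mu>_def
      by (subst emeasure_distr, simp, simp, subst emeasure_density, simp, measurable)
         (auto intro!: nn_integral_cong simp: indicator_def)
    also have "\<dots> = (if 0 < t then ennreal (t ^ DIM('a)) * m else 0)"
    proof (cases "0 < t")
      case True
      then show ?thesis unfolding m_def using nn_integral_scaleR_ball[of \<phi> t] hom by simp
    next
      case False
      then have "indicator (ball 0 t) h = (0::ennreal)" for h :: 'a
        by (auto simp: indicator_def) (meson le_less_trans norm_ge_zero)
      then show ?thesis using False by simp
    qed
    finally show ?thesis .
  qed
  have \<nu>: "emeasure \<nu> {..<t} = (if 0 < t then ennreal (t ^ DIM('a)) * m else 0)" for t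
  proof -
    have "emeasure \<nu> {..<t} = (\<integral>\<^sup>+r. (ennreal DIM('a) * m) * (ennreal (r ^ (DIM('a) - 1)) * indicator {0<..} r * indicator {..<t} r) \<partial>lborel)"
      unfolding \<nu>_def by (subst emeasure_density) (auto simp: w_def mult_ac intro!: nn_integral_cong)
    also have "\<dots> = ennreal DIM('a) * m * (\<integral>\<^sup>+r. ennreal (r ^ (DIM('a) - 1)) * indicator {0<..} r * indicator {..<t} r \<partial>lborel)"
      by (rule nn_integral_cmult) auto
    also have "(\<integral>\<^sup>+r. ennreal (r ^ (DIM('a) - 1)) * indicator {0<..} r * indicator {..<t} r \<partial>lborel)
        = (if 0 < t then ennreal (t ^ DIM('a) / DIM('a)) else 0)"
    proof (cases "0 < t")
      case True
      have "(\<integral>\<^sup>+r. ennreal (r ^ (DIM('a) - 1)) * indicator {0<..} r * indicator {..<t} r \<partial>lborel)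
          = (\<integral>\<^sup>+r. ennreal (r ^ (DIM('a) - 1)) * indicator {0..t} r \<partial>lborel)"
        by (intro nn_integral_cong_AE) 
          (use AE_lborel_singleton[of 0] AE_lborel_singleton[of t] in eventually_elim, auto simp: indicator_def)
      also have "\<dots> = t ^ DIM('a) / DIM('a) - 0 ^ DIM('a) / DIM('a)"
        using True by (intro nn_integral_FTC_Icc) (auto intro!: derivative_eq_intros)
      finally show ?thesis using True by (simp add: zero_power)
    next
      case False
      then have "ennreal (r ^ (DIM('a) - 1)) * indicator {0<..} r * indicator {..<t} r = 0" for r
        by (auto simp: indicator_def)
      then show ?thesis using False by (simp only: nn_integral_const) simp
    qed
    finally show ?thesis
      by (auto simp: mult_ac ennreal_mult'[symmetric] mult.left_commute[of _ m])
  qed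
  have eq: "\<mu> = \<nu>"
  proof (rule measure_eqI_generator_eq[where E = "range lessThan" and \<Omega> = UNIV and A = "\<lambda>n. {..<real n}"])
    show "Int_stable (range (lessThan :: real \<Rightarrow> _))"
    proof -
      have "{..<a} \<inter> {..<b} = {..<min a b}" for a b :: real by auto
      then show ?thesis by (auto simp: Int_stable_def)
    qed
    have "sets (borel :: real measure) = sigma_sets UNIV (range lessThan)"
      by (subst borel_Iio) (simp add: sets_measure_of)
    then show "sets \<mu> = sigma_sets UNIV (range lessThan)" "sets \<nu> = sigma_sets UNIV (range lessThan)"
      by (simp_all add: \<mu>_def \<nu>_def)
    show "(\<Union>i. {..<real i}) = UNIV" using reals_Archimedean2 by auto
    show "emeasure \<mu> {..<real i} \<noteq> \<infinity>" for i
      using fin by (auto simp: \<mu> m_def[symmetric] ennreal_mult_eq_top_iff)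
  qed (auto simp: \<mu> \<nu>)
  have "(\<integral>\<^sup>+h. \<phi> h * \<psi> (norm h) \<partial>lborel) = (\<integral>\<^sup>+r. \<psi> r \<partial>\<mu>)"
    unfolding \<mu>_def by (subst nn_integral_distr) (auto simp: nn_integral_density)
  also have "\<dots> = (\<integral>\<^sup>+r. (ennreal DIM('a) * m) * (\<psi> r * ennreal (r ^ (DIM('a) - 1)) * indicator {0<..} r) \<partial>lborel)"
    unfolding eq \<nu>_def by (subst nn_integral_density) (auto intro!: nn_integral_cong simp: w_def mult_ac)
  also have "\<dots> = ennreal DIM('a) * m * (\<integral>\<^sup>+r\<in>{0<..}. \<psi> r * ennreal (r ^ (DIM('a) - 1)) \<partial>lborel)"
    by (rule nn_integral_cmult) auto
  finally show ?thesis unfolding m_def .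
qed

text \<open>
  Euler's integral for \<open>\<Gamma>\<close> after the substitution of \<open>r\<^sup>2\<close> for the variable of integration.
\<close>

lemma nn_integral_powr_exp_minus_square:
  assumes "-1 < (q::real)"
  shows "(\<integral>\<^sup>+r\<in>{0<..}. ennreal (r powr q * exp (- r\<^sup>2)) \<partial>lborel) = ennreal (Gamma ((q + 1) / 2) / 2)"
proof -
  define f where "f = (\<lambda>t::real. t powr ((q + 1) / 2 - 1) / exp t)"
  have img: "(\<lambda>r::real. r\<^sup>2) ` {0<..} = {0<..}"
  proof safe
    fix t :: real assume "0 < t"
    then show "t \<in> (\<lambda>r. r\<^sup>2) ` {0<..}" by (intro image_eqI[of _ _ "sqrt t"]) auto
  qed auto
  have z: "0 < (q + 1) / 2" using assms by simp
  have "(f has_integral Gamma ((q + 1) / 2)) {0..}"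
    unfolding f_def by (rule Gamma_integral_real[OF z])
  then have I: "(f has_integral Gamma ((q + 1) / 2)) {0<..}"
  proof (rule iffD1[OF has_integral_spike_set_eq, rotated 2])
    show "negligible {x \<in> {0..} - {0<..}. f x \<noteq> 0}"
      by (rule negligible_subset[of "{0}"]) auto
    show "negligible {x \<in> {0<..} - {0..}. f x \<noteq> 0}"
      by (rule negligible_subset[of "{0}"]) auto
  qed
  have ai: "f absolutely_integrable_on {0<..}"
    by (rule nonnegative_absolutely_integrable_1[OF has_integral_integrable[OF I]]) (simp add: f_def)
  have "(\<lambda>r. \<bar>2 * r\<bar> * f (r\<^sup>2)) absolutely_integrable_on {0<..} \<and>
         integral {0<..} (\<lambda>r. \<bar>2 * r\<bar> * f (r\<^sup>2)) = Gamma ((q + 1) / 2)"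
  proof (rule iffD2[OF has_absolute_integral_change_of_variables_1'[where g = "\<lambda>r. r\<^sup>2" and g' = "\<lambda>r. 2 * r"]])
    show "inj_on (\<lambda>r::real. r\<^sup>2) {0<..}"
      by (rule inj_onI) (simp add: power2_eq_iff_nonneg)
    show "((\<lambda>r::real. r\<^sup>2) has_field_derivative 2 * r) (at r within {0<..})" if "r \<in> {0<..}" for r
      by (auto intro!: derivative_eq_intros)
    show "f absolutely_integrable_on power2 ` {0<..} \<and> integral (power2 ` {0<..}) f = Gamma ((q + 1) / 2)"
      unfolding img using ai integral_unique[OF I] by blast
  qed simp
  note R = this
  have e: "2 * ((q + 1) / 2 - 1) = q - 1" by (simp add: field_simps)
  have J: "((\<lambda>r. \<bar>2 * r\<bar> * f (r\<^sup>2)) has_integral Gamma ((q + 1) / 2)) {0<..}"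
    using integrable_integral[OF set_lebesgue_integral_eq_integral(1)[OF conjunct1[OF R]]]
    by (simp only: conjunct2[OF R])
  have "((\<lambda>r. (1/2) * (\<bar>2 * r\<bar> * f (r\<^sup>2))) has_integral (1/2) * Gamma ((q + 1) / 2)) {0<..}"
    by (rule has_integral_mult_right[OF J])
  then have "((\<lambda>r. r powr q * exp (- r\<^sup>2)) has_integral Gamma ((q + 1) / 2) / 2) {0<..}"
  proof (rule has_integral_eq_rhs[OF has_integral_eq, rotated])
    fix r :: real assume "r \<in> {0<..}"
    then have "0 < r" by simp
    then have "(r\<^sup>2) powr ((q + 1) / 2 - 1) = r powr (q - 1)"
      using powr_powr[of r 2 "(q + 1) / 2 - 1", unfolded e] by simp
    then have "r * (r\<^sup>2) powr ((q + 1) / 2 - 1) = r powr q"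
      using powr_mult_base[of r "q - 1"] \<open>0 < r\<close> by simp
    then show "1 / 2 * (\<bar>2 * r\<bar> * f (r\<^sup>2)) = r powr q * exp (- r\<^sup>2)"
      using \<open>0 < r\<close> by (simp add: f_def exp_minus field_simps)
  qed simp
  from nn_integral_has_integral_lebesgue[OF _ this] show ?thesis
    by (simp add: mult.commute ennreal_mult' ennreal_indicator)
qed

section \<open>The Gaussian measure\<close>

text \<open>
  Variance \<open>1 / 2\<close> makes the exponent of the normal density equal to \<open>- t\<^sup>2\<close>, which keeps powers of 2
  out of the constants.
\<close>

lemma normal_density_half:
  "normal_density 0 (sqrt (1 / 2)) t = exp (- t\<^sup>2) / sqrt pi"
  unfolding normal_density_def by (simp add: power_divide)

definition gaussian :: "'a::euclidean_space measure" where
  "gaussian = density lborel (\<lambda>h. \<Prod>b\<in>Basis. ennreal (normal_density 0 (sqrt (1 / 2)) (h \<bullet> b)))"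

lemma sets_gaussian [simp, measurable_cong]: "sets gaussian = sets borel"
  by (simp add: gaussian_def)

lemma space_gaussian [simp]: "space gaussian = UNIV"
  by (simp add: gaussian_def)

lemma emeasure_gaussian_box:
  fixes A :: "'a::euclidean_space \<Rightarrow> real set"
  assumes [measurable]: "\<And>b. b \<in> Basis \<Longrightarrow> A b \<in> sets borel"
  shows "emeasure gaussian {h. \<forall>b\<in>Basis. h \<bullet> b \<in> A b}
       = (\<Prod>b\<in>Basis. emeasure (density lborel (normal_density 0 (sqrt (1 / 2)))) (A b))"
proof -
  have "{h. \<forall>b\<in>Basis. h \<bullet> b \<in> A b} = (\<Inter>b\<in>Basis. (\<lambda>h. h \<bullet> b) -` A b)" by auto
  also have "\<dots> \<in> sets borel"
  proof (rule sets.finite_INT)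
    fix b :: 'a assume "b \<in> Basis"
    then have "A b \<in> sets borel" by (rule assms)
    then show "(\<lambda>h. h \<bullet> b) -` A b \<in> sets borel"
      using measurable_sets[of "\<lambda>h. h \<bullet> b" borel borel "A b"] by simp
  qed auto
  finally have [measurable]: "{h. \<forall>b\<in>Basis. h \<bullet> b \<in> A b} \<in> sets borel" .
  have "emeasure gaussian {h. \<forall>b\<in>Basis. h \<bullet> b \<in> A b}
      = (\<integral>\<^sup>+h. (\<Prod>b\<in>Basis. ennreal (normal_density 0 (sqrt (1 / 2)) (h \<bullet> b)) * indicator (A b) (h \<bullet> b)) \<partial>lborel)"
    unfolding gaussian_def
    by (subst emeasure_density)
      (auto simp: indicator_def prod.distrib intro!: nn_integral_cong prod_zero_iff[THEN iffD2])
  also have "\<dots> = (\<Prod>b\<in>Basis. (\<integral>\<^sup>+x. ennreal (normal_density 0 (sqrt (1 / 2)) x) * indicator (A b) x \<partial>lborel))"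
    by (rule nn_integral_lborel_prod) auto
  also have "\<dots> = (\<Prod>b\<in>Basis. emeasure (density lborel (normal_density 0 (sqrt (1 / 2)))) (A b))"
    by (intro prod.cong refl) (simp add: emeasure_density)
  finally show ?thesis .
qed

lemma emeasure_normal_UNIV: "emeasure (density lborel (normal_density 0 (sqrt (1 / 2)))) UNIV = 1"
  using prob_space.emeasure_space_1[OF prob_space_normal_density[of "sqrt (1/2)" 0]] by simp

interpretation gaussian: prob_space "gaussian :: 'a::euclidean_space measure"
proof
  show "emeasure gaussian (space (gaussian :: 'a measure)) = 1"
    using emeasure_gaussian_box[of "\<lambda>_::'a. UNIV"] by (simp add: emeasure_normal_UNIV)
qed

lemma distr_gaussian_coordinate:
  assumes b: "b \<in> (Basis :: 'a::euclidean_space set)"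
  shows "distr gaussian borel (\<lambda>h::'a. h \<bullet> b) = density lborel (normal_density 0 (sqrt (1 / 2)))"
proof (rule measure_eqI)
  fix A assume "A \<in> sets (distr gaussian borel (\<lambda>h::'a. h \<bullet> b))"
  then have [measurable]: "A \<in> sets borel" by simp
  have "emeasure (distr gaussian borel (\<lambda>h::'a. h \<bullet> b)) A = emeasure gaussian {h::'a. \<forall>c\<in>Basis. h \<bullet> c \<in> (if c = b then A else UNIV)}"
    using b by (subst emeasure_distr) (auto intro!: arg_cong[where f = "emeasure gaussian"] split: if_splits)
  also have "\<dots> = (\<Prod>c\<in>Basis. emeasure (density lborel (normal_density 0 (sqrt (1 / 2)))) (if c = b then A else UNIV))"
    by (rule emeasure_gaussian_box) simp
  also have "\<dots> = emeasure (density lborel (normal_density 0 (sqrt (1 / 2)))) A"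
    using b by (simp add: if_distrib emeasure_normal_UNIV prod.delta cong: if_cong)
  finally show "emeasure (distr gaussian borel (\<lambda>h::'a. h \<bullet> b)) A = emeasure (density lborel (normal_density 0 (sqrt (1 / 2)))) A" .
qed simp

lemma indep_vars_gaussian_coordinates:
  "gaussian.indep_vars (\<lambda>_. borel) (\<lambda>b h::'a::euclidean_space. h \<bullet> b) Basis"
proof (subst gaussian.indep_vars_iff_distr_eq_PiM')
  interpret N: prob_space "density lborel (normal_density 0 (sqrt (1 / 2)))"
    by (rule prob_space_normal_density) simp
  interpret product_sigma_finite "\<lambda>_::'a. density lborel (normal_density 0 (sqrt (1 / 2)))" ..
  have "distr gaussian (\<Pi>\<^sub>M i\<in>Basis. borel) (\<lambda>x. \<lambda>b\<in>Basis. x \<bullet> b)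
      = (\<Pi>\<^sub>M b\<in>(Basis::'a set). density lborel (normal_density 0 (sqrt (1 / 2))))"
  proof (rule PiM_eqI)
    fix A :: "'a \<Rightarrow> real set"
    assume A: "\<And>b. b \<in> Basis \<Longrightarrow> A b \<in> sets (density lborel (normal_density 0 (sqrt (1 / 2))))"
    then have [measurable]: "\<And>b. b \<in> Basis \<Longrightarrow> A b \<in> sets borel" by simp
    have "emeasure (distr gaussian (\<Pi>\<^sub>M i\<in>Basis. borel) (\<lambda>x::'a. \<lambda>b\<in>Basis. x \<bullet> b)) (Pi\<^sub>E Basis A)
       = emeasure gaussian {h::'a. \<forall>c\<in>Basis. h \<bullet> c \<in> A c}"
      by (subst emeasure_distr)
         (auto intro!: arg_cong[where f = "emeasure gaussian"] simp: restrict_PiE_iff)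
    also have "\<dots> = (\<Prod>b\<in>Basis. emeasure (density lborel (normal_density 0 (sqrt (1 / 2)))) (A b))"
      by (rule emeasure_gaussian_box) simp
    finally show "emeasure (distr gaussian (\<Pi>\<^sub>M i\<in>Basis. borel) (\<lambda>x::'a. \<lambda>b\<in>Basis. x \<bullet> b)) (Pi\<^sub>E Basis A)
       = (\<Prod>b\<in>Basis. emeasure (density lborel (normal_density 0 (sqrt (1 / 2)))) (A b))" .
  qed (auto intro!: sets_PiM_cong)
  then show "distr gaussian (\<Pi>\<^sub>M i\<in>Basis. borel) (\<lambda>x. \<lambda>b\<in>Basis. x \<bullet> b)
      = (\<Pi>\<^sub>M b\<in>(Basis::'a set). distr gaussian borel (\<lambda>x. x \<bullet> b))"
    by (simp add: distr_gaussian_coordinate cong: PiM_cong)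
qed auto

text \<open>
  This stands in for rotation invariance: \<open>v \<bullet> h\<close> is the sum of the independent normal variables
  \<open>(v \<bullet> b) (h \<bullet> b)\<close>, and the variances add up to \<open>1 / 2\<close> because \<open>v\<close> is a unit vector.
\<close>

lemma distributed_gaussian_inner:
  fixes v :: "'a::euclidean_space"
  assumes "norm v = 1"
  shows "distributed gaussian lborel (\<lambda>h. v \<bullet> h) (normal_density 0 (sqrt (1 / 2)))"
proof -
  \<comment> \<open>coordinates with coefficient 0 contribute degenerate variables, which have no normal density\<close>
  define I where "I = {b\<in>Basis. v \<bullet> b \<noteq> 0}"
  have I: "finite I" "I \<subseteq> Basis" by (auto simp: I_def)
  have sq: "(\<Sum>b\<in>I. (v \<bullet> b)\<^sup>2) = 1"
  proof -
    have "(\<Sum>b\<in>I. (v \<bullet> b)\<^sup>2) = (\<Sum>b\<in>Basis. (v \<bullet> b)\<^sup>2)"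
      by (rule sum.mono_neutral_left) (auto simp: I_def)
    also have "\<dots> = v \<bullet> v" by (subst euclidean_inner) (simp add: power2_eq_square)
    finally show ?thesis using assms by (simp add: dot_square_norm)
  qed
  have "distributed gaussian lborel (\<lambda>h. \<Sum>b\<in>I. (v \<bullet> b) * (h \<bullet> b))
     (normal_density (\<Sum>b\<in>I. 0) (sqrt (\<Sum>b\<in>I. (\<bar>v \<bullet> b\<bar> * sqrt (1 / 2))\<^sup>2)))"
  proof (rule gaussian.sum_indep_normal)
    show "gaussian.indep_vars (\<lambda>i. borel) (\<lambda>b h. (v \<bullet> b) * (h \<bullet> b)) I"
      by (rule gaussian.indep_vars_compose2[OF gaussian.indep_vars_subset[OF indep_vars_gaussian_coordinates I(2)]]) simp
    show "I \<noteq> {}" using sq by auto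
    show "distributed gaussian lborel (\<lambda>h. (v \<bullet> b) * (h \<bullet> b)) (normal_density 0 (\<bar>v \<bullet> b\<bar> * sqrt (1 / 2)))"
      if "b \<in> I" for b
    proof -
      have "distributed gaussian lborel (\<lambda>h. h \<bullet> b) (normal_density 0 (sqrt (1 / 2)))"
        using that I unfolding distributed_def
        by (auto simp: distr_gaussian_coordinate[symmetric] cong: distr_cong)
      from gaussian.normal_density_affine[OF this, of "v \<bullet> b" 0] that
      show ?thesis by (simp add: I_def)
    qed
    show "0 < \<bar>v \<bullet> b\<bar> * sqrt (1 / 2)" if "b \<in> I" for b
      using that by (simp add: I_def)
  qed (auto simp: I)
  moreover have "(\<Sum>b\<in>I. (v \<bullet> b) * (h \<bullet> b)) = v \<bullet> h" for h
    by (subst euclidean_inner[of v h], rule sum.mono_neutral_left) (auto simp: I_def)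
  moreover have "(\<Sum>b\<in>I. (\<bar>v \<bullet> b\<bar> * sqrt (1 / 2))\<^sup>2) = 1 / 2"
    using sq by (simp add: power_mult_distrib sum_divide_distrib[symmetric])
  ultimately show ?thesis by simp
qed

lemma nn_integral_inner_exp_minus_square:
  fixes v :: "'a::euclidean_space" and f :: "real \<Rightarrow> ennreal"
  assumes "norm v = 1" and [measurable]: "f \<in> borel_measurable borel"
  shows "(\<integral>\<^sup>+h. f (v \<bullet> h) * ennreal (exp (- (norm h)\<^sup>2)) \<partial>lborel)
       = ennreal (sqrt pi ^ (DIM('a) - 1)) * (\<integral>\<^sup>+t. f t * ennreal (exp (- t\<^sup>2)) \<partial>lborel)"
proof -
  have dens: "ennreal (exp (- (norm h)\<^sup>2))
      = ennreal (sqrt pi ^ DIM('a)) * (\<Prod>b\<in>Basis. ennreal (normal_density 0 (sqrt (1 / 2)) (h \<bullet> b)))" for h :: 'a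
  proof -
    have "(norm h)\<^sup>2 = (\<Sum>b\<in>Basis. (h \<bullet> b)\<^sup>2)"
      by (subst dot_square_norm[symmetric], subst euclidean_inner) (simp add: power2_eq_square)
    then show ?thesis
      by (simp add: normal_density_half prod_ennreal prod_dividef exp_sum[symmetric] sum_negf
          ennreal_mult'[symmetric])
  qed
  have dens1: "ennreal (normal_density 0 (sqrt (1 / 2)) t) = ennreal (1 / sqrt pi) * ennreal (exp (- t\<^sup>2))" for t
    by (simp add: normal_density_half ennreal_mult'[symmetric])
  have "(\<integral>\<^sup>+h. f (v \<bullet> h) * ennreal (exp (- (norm h)\<^sup>2)) \<partial>lborel)
     = (\<integral>\<^sup>+h. ennreal (sqrt pi ^ DIM('a)) * ((\<Prod>b\<in>Basis. ennreal (normal_density 0 (sqrt (1 / 2)) (h \<bullet> b))) * f (v \<bullet> h)) \<partial>lborel)"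
    by (simp add: dens mult_ac)
  also have "\<dots> = ennreal (sqrt pi ^ DIM('a)) * (\<integral>\<^sup>+h. f (v \<bullet> h) \<partial>gaussian)"
    unfolding gaussian_def by (subst nn_integral_cmult, simp, subst nn_integral_density, auto)
  also have "(\<integral>\<^sup>+h. f (v \<bullet> h) \<partial>gaussian) = (\<integral>\<^sup>+t. ennreal (normal_density 0 (sqrt (1 / 2)) t) * f t \<partial>lborel)"
    by (rule distributed_nn_integral[OF distributed_gaussian_inner[OF assms(1)], symmetric]) simp
  also have "\<dots> = (\<integral>\<^sup>+t. ennreal (1 / sqrt pi) * (f t * ennreal (exp (- t\<^sup>2))) \<partial>lborel)"
    unfolding dens1 by (intro nn_integral_cong) (simp only: mult_ac)
  also have "\<dots> = ennreal (1 / sqrt pi) * (\<integral>\<^sup>+t. f t * ennreal (exp (- t\<^sup>2)) \<partial>lborel)"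
    by (rule nn_integral_cmult) simp
  also have "ennreal (sqrt pi ^ DIM('a)) * (ennreal (1 / sqrt pi) * (\<integral>\<^sup>+t. f t * ennreal (exp (- t\<^sup>2)) \<partial>lborel))
      = ennreal (sqrt pi ^ (DIM('a) - 1)) * (\<integral>\<^sup>+t. f t * ennreal (exp (- t\<^sup>2)) \<partial>lborel)"
  proof -
    have "sqrt pi ^ DIM('a) * (1 / sqrt pi) = sqrt pi ^ (DIM('a) - 1)"
      using DIM_positive[where 'a='a] by (cases "DIM('a)") auto
    then have "ennreal (sqrt pi ^ DIM('a)) * ennreal (1 / sqrt pi) = ennreal (sqrt pi ^ (DIM('a) - 1))"
      by (subst ennreal_mult'[symmetric]) auto
    then show ?thesis by (simp only: mult.assoc[symmetric])
  qed
  finally show ?thesis .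
qed

lemma nn_integral_abs_powr_exp_minus_square:
  assumes "0 \<le> (p::real)"
  shows "(\<integral>\<^sup>+t. ennreal (\<bar>t\<bar> powr p * exp (- t\<^sup>2)) \<partial>lborel) = ennreal (Gamma ((p + 1) / 2))"
proof -
  define I where "I = (\<integral>\<^sup>+t\<in>{0<..}. ennreal (t powr p * exp (- t\<^sup>2)) \<partial>lborel)"
  have "(\<integral>\<^sup>+t. ennreal (\<bar>t\<bar> powr p * exp (- t\<^sup>2)) \<partial>lborel)
     = (\<integral>\<^sup>+t. ennreal (t powr p * exp (- t\<^sup>2)) * indicator {0<..} t
         + ennreal ((- t) powr p * exp (- t\<^sup>2)) * indicator {0<..} (- t) \<partial>lborel)"
    by (intro nn_integral_cong_AE, use AE_lborel_singleton[of 0] in eventually_elim)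
       (auto simp: indicator_def abs_if)
  also have "\<dots> = I + (\<integral>\<^sup>+t. ennreal ((- t) powr p * exp (- t\<^sup>2)) * indicator {0<..} (- t) \<partial>lborel)"
    unfolding I_def by (rule nn_integral_add) auto
  also have "(\<integral>\<^sup>+t. ennreal ((- t) powr p * exp (- t\<^sup>2)) * indicator {0<..} (- t) \<partial>lborel) = I"
    unfolding I_def by (subst nn_integral_real_affine[of _ "-1" 0]) auto
  also have "I + I = ennreal (Gamma ((p + 1) / 2))"
    unfolding I_def using assms
    by (subst nn_integral_powr_exp_minus_square, simp, subst nn_integral_powr_exp_minus_square, simp)
       (simp add: ennreal_plus[symmetric] Gamma_real_pos less_imp_le del: ennreal_plus)
  finally show ?thesis .
qed

lemma nn_integral_inner_powr_exp_minus_square: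
  fixes v :: "'a::euclidean_space"
  assumes "0 < p"
  shows "(\<integral>\<^sup>+h. ennreal (\<bar>v \<bullet> h\<bar> powr p * exp (- (norm h)\<^sup>2)) \<partial>lborel)
       = ennreal (norm v powr p * (sqrt pi ^ (DIM('a) - 1) * Gamma ((p + 1) / 2)))"
proof (cases "v = 0")
  case True
  then show ?thesis using assms by simp
next
  case False
  define w where "w = v /\<^sub>R norm v"
  have w: "norm w = 1" "v = norm v *\<^sub>R w" using False by (auto simp: w_def)
  have "\<bar>v \<bullet> h\<bar> = norm v * \<bar>w \<bullet> h\<bar>" for h
    by (subst w(2)) (simp add: abs_mult)
  then have "(\<integral>\<^sup>+h. ennreal (\<bar>v \<bullet> h\<bar> powr p * exp (- (norm h)\<^sup>2)) \<partial>lborel)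
     = (\<integral>\<^sup>+h. ennreal (norm v powr p) * (ennreal (\<bar>w \<bullet> h\<bar> powr p) * ennreal (exp (- (norm h)\<^sup>2))) \<partial>lborel)"
    by (simp add: powr_mult ennreal_mult'[symmetric] mult.assoc)
  also have "\<dots> = ennreal (norm v powr p) * (\<integral>\<^sup>+h. ennreal (\<bar>w \<bullet> h\<bar> powr p) * ennreal (exp (- (norm h)\<^sup>2)) \<partial>lborel)"
    by (rule nn_integral_cmult) simp
  also have "\<dots> = ennreal (norm v powr p) * (ennreal (sqrt pi ^ (DIM('a) - 1)) *
      (\<integral>\<^sup>+t. ennreal (\<bar>t\<bar> powr p) * ennreal (exp (- t\<^sup>2)) \<partial>lborel))"
    using nn_integral_inner_exp_minus_square[OF w(1), of "\<lambda>t. ennreal (\<bar>t\<bar> powr p)"] by simp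
  also have "\<dots> = ennreal (norm v powr p * (sqrt pi ^ (DIM('a) - 1) * Gamma ((p + 1) / 2)))"
    using assms nn_integral_abs_powr_exp_minus_square[of p] by (simp add: ennreal_mult')
  finally show ?thesis .
qed

section \<open>The angular integral over a half-space\<close>

lemma nn_integral_even_half_space:
  fixes a :: "'a::euclidean_space" and f :: "'a \<Rightarrow> ennreal"
  assumes [measurable]: "f \<in> borel_measurable borel" and even: "\<And>h. f (- h) = f h" and a: "a \<noteq> 0"
  shows "2 * (\<integral>\<^sup>+h\<in>{h. 0 < a \<bullet> h}. f h \<partial>lborel) = (\<integral>\<^sup>+h. f h \<partial>lborel)"
proof -
  let ?H = "{h. 0 < a \<bullet> h}"
  have "{h. a \<bullet> h = 0} \<in> null_sets lborel"
    using negligible_hyperplane[of a 0] a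
    by (subst null_sets_completion_iff[symmetric]) (auto simp: negligible_iff_null_sets closed_hyperplane)
  then have ae: "AE h in lborel. a \<bullet> h \<noteq> 0"
    by (rule AE_not_in[THEN AE_mp]) simp
  have "(\<integral>\<^sup>+h. f h \<partial>lborel) = (\<integral>\<^sup>+h. f h * indicator ?H h + f (- h) * indicator ?H (- h) \<partial>lborel)"
    by (intro nn_integral_cong_AE, use ae in eventually_elim) (auto simp: even indicator_def)
  also have "\<dots> = (\<integral>\<^sup>+h\<in>?H. f h \<partial>lborel) + (\<integral>\<^sup>+h. f (- h) * indicator ?H (- h) \<partial>lborel)"
    by (rule nn_integral_add) auto
  also have "(\<integral>\<^sup>+h. f (- h) * indicator ?H (- h) \<partial>lborel) = (\<integral>\<^sup>+h. f h * indicator ?H h \<partial>distr lborel borel uminus)"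
    by (subst nn_integral_distr) auto
  also have "distr lborel borel uminus = (lborel :: 'a measure)"
    using lborel_affine[of "-1::real" "0::'a"] by (simp add: density_1)
  finally show ?thesis by (simp add: mult_2)
qed

text \<open>
  Both sides of this identity are what remains of the Gaussian integral of \<open>\<bar>v \<bullet> h\<bar>\<^sup>p\<close> over the
  half-space when the radial factor \<open>\<Gamma>((N + p) / 2) / 2\<close> is divided out. The half-space may be cut
  off by any hyperplane through 0, whatever its position relative to \<open>v\<close>, since the integrand is even.
\<close>

lemma nn_integral_angular_half_space:
  fixes a v :: "'a::euclidean_space" and p :: real
  assumes a: "a \<noteq> 0" and p: "0 < p"
  shows "ennreal DIM('a) * (\<integral>\<^sup>+h. ennreal ((\<bar>v \<bullet> h\<bar> / norm h) powr p) * indicator {h. 0 < a \<bullet> h} h * indicator (ball 0 1) h \<partial>lborel)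
     = ennreal (norm v powr p * (sqrt pi ^ (DIM('a) - 1) * Gamma ((p + 1) / 2) / Gamma ((DIM('a) + p) / 2)))"
    (is "_ * ?M = ennreal ?K")
proof -
  let ?H = "{h. 0 < a \<bullet> h}"
  define \<phi> where "\<phi> = (\<lambda>h. ennreal ((\<bar>v \<bullet> h\<bar> / norm h) powr p) * indicator ?H h)"
  define g where "g = Gamma ((DIM('a) + p) / 2)"
  have g: "0 < g" unfolding g_def using p by (intro Gamma_real_pos) auto
  have [measurable]: "ball (0::'a) 1 \<in> sets borel" by simp
  have [measurable]: "\<phi> \<in> borel_measurable borel" unfolding \<phi>_def by measurable
  have "?M \<le> (\<integral>\<^sup>+h. ennreal (norm v powr p) * indicator (ball (0::'a) 1) h \<partial>lborel)"
  proof (rule nn_integral_mono)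
    fix h :: 'a
    have "\<bar>v \<bullet> h\<bar> / norm h \<le> norm v"
      using Cauchy_Schwarz_ineq2[of v h] by (cases "h = 0") (auto simp: field_simps)
    then have "(\<bar>v \<bullet> h\<bar> / norm h) powr p \<le> norm v powr p"
      using p by (intro powr_mono2) auto
    then show "ennreal ((\<bar>v \<bullet> h\<bar> / norm h) powr p) * indicator ?H h * indicator (ball 0 1) h
        \<le> ennreal (norm v powr p) * indicator (ball 0 1) h"
      by (auto simp: indicator_def intro: ennreal_leI)
  qed
  also have "\<dots> < \<infinity>"
    by (subst nn_integral_cmult_indicator) (auto simp: emeasure_ball ennreal_mult_less_top)
  finally have fin: "(\<integral>\<^sup>+h. \<phi> h * indicator (ball 0 1) h \<partial>lborel) < \<infinity>" by (simp add: \<phi>_def)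
  have hom: "\<phi> (t *\<^sub>R h) = \<phi> h" if "0 < t" for t h
    using that by (simp add: \<phi>_def abs_mult indicator_def zero_less_mult_iff)
  have rad: "(\<integral>\<^sup>+r\<in>{0<..}. ennreal (r powr p * exp (- r\<^sup>2)) * ennreal (r ^ (DIM('a) - 1)) \<partial>lborel) = ennreal (g / 2)"
  proof -
    have "(\<integral>\<^sup>+r\<in>{0<..}. ennreal (r powr p * exp (- r\<^sup>2)) * ennreal (r ^ (DIM('a) - 1)) \<partial>lborel)
        = (\<integral>\<^sup>+r\<in>{0<..}. ennreal (r powr (DIM('a) + p - 1) * exp (- r\<^sup>2)) \<partial>lborel)"
    proof (intro nn_integral_cong)
      fix r :: real
      have "r powr p * exp (- r\<^sup>2) * r ^ (DIM('a) - 1) = r powr (DIM('a) + p - 1) * exp (- r\<^sup>2)" if "0 < r"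
      proof -
        have "r ^ (DIM('a) - 1) = r powr (DIM('a) - 1)"
          using that DIM_positive[where 'a='a] by (simp add: powr_realpow[symmetric] of_nat_diff)
        moreover have "r powr p * r powr (DIM('a) - 1) = r powr (DIM('a) + p - 1)"
          unfolding powr_add[symmetric] by (rule arg_cong[where f = "\<lambda>x. r powr x"]) simp
        ultimately show ?thesis by (metis mult.assoc mult.commute)
      qed
      then show "ennreal (r powr p * exp (- r\<^sup>2)) * ennreal (r ^ (DIM('a) - 1)) * indicator {0<..} r
           = ennreal (r powr (DIM('a) + p - 1) * exp (- r\<^sup>2)) * indicator {0<..} r"
        by (auto simp: indicator_def ennreal_mult'[symmetric])
    qed
    also have "\<dots> = ennreal (Gamma ((DIM('a) + p - 1 + 1) / 2) / 2)"
      using p DIM_positive[where 'a='a] by (intro nn_integral_powr_exp_minus_square) linarith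
    finally show ?thesis by (simp add: g_def)
  qed
  define m where "m = (\<integral>\<^sup>+h. \<phi> h * indicator (ball 0 1) h \<partial>lborel)"
  have "ennreal DIM('a) * m * ennreal (g / 2) = (\<integral>\<^sup>+h. \<phi> h * ennreal (norm h powr p * exp (- (norm h)\<^sup>2)) \<partial>lborel)"
    unfolding m_def rad[symmetric]
    by (rule nn_integral_homogeneous_times_radial[symmetric, OF _ _ hom fin]) auto
  also have "\<dots> = (\<integral>\<^sup>+h\<in>?H. ennreal (\<bar>v \<bullet> h\<bar> powr p * exp (- (norm h)\<^sup>2)) \<partial>lborel)"
  proof (intro nn_integral_cong)
    fix h
    have "(\<bar>v \<bullet> h\<bar> / norm h) powr p * (norm h powr p * exp (- (norm h)\<^sup>2)) = \<bar>v \<bullet> h\<bar> powr p * exp (- (norm h)\<^sup>2)"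
      by (cases "h = 0") (simp_all add: powr_divide)
    then show "\<phi> h * ennreal (norm h powr p * exp (- (norm h)\<^sup>2))
        = ennreal (\<bar>v \<bullet> h\<bar> powr p * exp (- (norm h)\<^sup>2)) * indicator ?H h"
      by (auto simp: \<phi>_def indicator_def ennreal_mult'[symmetric])
  qed
  finally have "2 * (ennreal DIM('a) * m * ennreal (g / 2)) = ennreal (norm v powr p * (sqrt pi ^ (DIM('a) - 1) * Gamma ((p + 1) / 2)))"
    using nn_integral_even_half_space[of "\<lambda>h. ennreal (\<bar>v \<bullet> h\<bar> powr p * exp (- (norm h)\<^sup>2))" a] a
    by (simp add: nn_integral_inner_powr_exp_minus_square[OF p])
  moreover have "2 * (ennreal DIM('a) * m * ennreal (g / 2)) = ennreal DIM('a) * m * ennreal g"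
  proof -
    have "ennreal g = 2 * ennreal (g / 2)" using ennreal_mult'[of 2 "g / 2"] by simp
    then show ?thesis by (simp only: mult_ac)
  qed
  ultimately have "ennreal DIM('a) * m * ennreal g * ennreal (1 / g)
      = ennreal (norm v powr p * (sqrt pi ^ (DIM('a) - 1) * Gamma ((p + 1) / 2))) * ennreal (1 / g)" by simp
  also have "\<dots> = ennreal ?K"
    using g p by (subst ennreal_mult'[symmetric]) (auto simp: g_def Gamma_real_pos less_imp_le)
  also have "ennreal DIM('a) * m * ennreal g * ennreal (1 / g) = ennreal DIM('a) * m"
    using ennreal_mult'[of "1/g" g] g mult.commute[of "ennreal g"] by (simp add: mult.assoc)
  finally show ?thesis by (simp only: m_def \<phi>_def)
qed

section \<open>Concentration of the weight at the origin\<close>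

text \<open>
  Two-sided bounds in which the error is added, never subtracted: subtraction of extended nonnegative
  numbers is truncated.
\<close>

lemma tendsto_ennreal_bounds:
  fixes F :: "real \<Rightarrow> ennreal"
  assumes "0 \<le> m"
    and ev: "\<And>e. 0 < e \<Longrightarrow> eventually (\<lambda>s. F s \<le> ennreal (m + e) \<and> ennreal m \<le> F s + ennreal e) G"
  shows "(F \<longlongrightarrow> ennreal m) G"
proof -
  have "((\<lambda>s. enn2real (F s)) \<longlongrightarrow> m) G"
  proof (rule tendstoI)
    fix e :: real assume "0 < e"
    then have "0 < e / 2" by simp
    from ev[OF this] show "eventually (\<lambda>s. dist (enn2real (F s)) m < e) G"
    proof eventually_elim
      case (elim s)
      then obtain x where x: "F s = ennreal x" "0 \<le> x" by (cases "F s") (auto simp: top_unique)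
      have "x \<le> m + e / 2"
        using elim x \<open>0 \<le> m\<close> \<open>0 < e\<close> by (simp add: ennreal_plus[symmetric] del: ennreal_plus)
      moreover have "m \<le> x + e / 2"
        using elim x \<open>0 \<le> m\<close> \<open>0 < e\<close> by (simp add: ennreal_plus[symmetric] del: ennreal_plus)
      ultimately show ?case using x \<open>0 < e\<close> by (simp add: dist_real_def abs_le_iff)
    qed
  qed
  then have "((\<lambda>s. ennreal (enn2real (F s))) \<longlongrightarrow> ennreal m) G" by (rule tendsto_ennrealI)
  moreover have "eventually (\<lambda>s. ennreal (enn2real (F s)) = F s) G"
    using ev[OF zero_less_one] by eventually_elim (auto simp: top_unique less_top[symmetric] intro!: ennreal_enn2real)
  ultimately show ?thesis by (rule Lim_transform_eventually)
qed

lemma radial_powr_near_zero: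
  assumes "0 < a" "0 < \<delta>" "0 < (n::nat)"
  shows "(\<integral>\<^sup>+r\<in>{0<..}. (ennreal (r powr (a - n)) * indicator {..<\<delta>} r) * ennreal (r ^ (n - 1)) \<partial>lborel)
       = ennreal (\<delta> powr a / a)"
proof -
  have "((\<lambda>r. r powr (a - 1)) has_integral (\<delta> powr (a - 1 + 1) / (a - 1 + 1))) {0..\<delta>}"
    using assms by (intro has_integral_powr_from_0) auto
  from nn_integral_has_integral_lebesgue[OF _ this]
  have "(\<integral>\<^sup>+r. ennreal (r powr (a - 1)) * indicator {0..\<delta>} r \<partial>lborel) = ennreal (\<delta> powr a / a)"
    by (simp add: mult.commute ennreal_mult' ennreal_indicator)
  moreover have "r powr (a - n) * r ^ (n - 1) = r powr (a - 1)" if "0 < r" for r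
    using that assms by (simp add: powr_realpow[symmetric] powr_add[symmetric] of_nat_diff algebra_simps)
  then have "(\<integral>\<^sup>+r\<in>{0<..}. (ennreal (r powr (a - n)) * indicator {..<\<delta>} r) * ennreal (r ^ (n - 1)) \<partial>lborel)
      = (\<integral>\<^sup>+r. ennreal (r powr (a - 1)) * indicator {0..\<delta>} r \<partial>lborel)"
    using assms
    by (intro nn_integral_cong_AE, use AE_lborel_singleton[of 0] AE_lborel_singleton[of \<delta>] in eventually_elim)
       (auto simp: indicator_def ennreal_mult'[symmetric])
  ultimately show ?thesis by simp
qed

lemma radial_powr_near_infinity:
  assumes "0 < b" "0 < \<delta>" "0 < (n::nat)"
  shows "(\<integral>\<^sup>+r\<in>{0<..}. (ennreal (r powr (- b - n)) * indicator {\<delta>..} r) * ennreal (r ^ (n - 1)) \<partial>lborel)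
       = ennreal (\<delta> powr - b / b)"
proof -
  have "((\<lambda>r. r powr (- b - 1)) has_integral - (\<delta> powr (- b - 1 + 1)) / (- b - 1 + 1)) {\<delta>..}"
    using assms by (intro has_integral_powr_to_inf) auto
  from nn_integral_has_integral_lebesgue[OF _ this]
  have "(\<integral>\<^sup>+r. ennreal (r powr (- b - 1)) * indicator {\<delta>..} r \<partial>lborel) = ennreal (\<delta> powr - b / b)"
    by (simp add: mult.commute ennreal_mult' ennreal_indicator)
  moreover have "r powr (- b - n) * r ^ (n - 1) = r powr (- b - 1)" if "0 < r" for r
    using that assms by (simp add: powr_realpow[symmetric] powr_add[symmetric] of_nat_diff algebra_simps minus_diff_commute)
  then have "(\<integral>\<^sup>+r\<in>{0<..}. (ennreal (r powr (- b - n)) * indicator {\<delta>..} r) * ennreal (r ^ (n - 1)) \<partial>lborel)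
      = (\<integral>\<^sup>+r. ennreal (r powr (- b - 1)) * indicator {\<delta>..} r \<partial>lborel)"
    using assms
    by (intro nn_integral_cong) (auto simp: indicator_def ennreal_mult'[symmetric])
  ultimately show ?thesis by simp
qed

lemma nn_integral_homogeneous_near_zero:
  fixes \<phi> :: "'a::euclidean_space \<Rightarrow> ennreal" and a \<delta> :: real
  assumes [measurable]: "\<phi> \<in> borel_measurable borel"
    and hom: "\<And>t h. 0 < t \<Longrightarrow> \<phi> (t *\<^sub>R h) = \<phi> h"
    and fin: "(\<integral>\<^sup>+h. \<phi> h * indicator (ball 0 1) h \<partial>lborel) < \<infinity>"
    and "0 < a" "0 < \<delta>"
  shows "(\<integral>\<^sup>+h\<in>ball 0 \<delta>. \<phi> h * ennreal (norm h powr (a - DIM('a))) \<partial>lborel)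
       = ennreal DIM('a) * (\<integral>\<^sup>+h. \<phi> h * indicator (ball 0 1) h \<partial>lborel) * ennreal (\<delta> powr a / a)"
proof -
  have "(\<integral>\<^sup>+h\<in>ball 0 \<delta>. \<phi> h * ennreal (norm h powr (a - DIM('a))) \<partial>lborel)
     = (\<integral>\<^sup>+h. \<phi> h * (ennreal (norm h powr (a - DIM('a))) * indicator {..<\<delta>} (norm h)) \<partial>lborel)"
    by (intro nn_integral_cong) (simp add: indicator_def)
  also have "\<dots> = ennreal DIM('a) * (\<integral>\<^sup>+h. \<phi> h * indicator (ball 0 1) h \<partial>lborel) * ennreal (\<delta> powr a / a)"
    using radial_powr_near_zero[OF \<open>0 < a\<close> \<open>0 < \<delta>\<close> DIM_positive[where 'a='a]]
    by (subst nn_integral_homogeneous_times_radial[of \<phi> "\<lambda>r. ennreal (r powr (a - DIM('a))) * indicator {..<\<delta>} r", OF _ _ hom fin]) auto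
  finally show ?thesis .
qed

lemma nn_integral_powr_near_infinity:
  fixes b \<delta> :: real
  assumes "0 < b" "0 < \<delta>"
  shows "(\<integral>\<^sup>+h\<in>- ball 0 \<delta>. ennreal (norm (h::'a::euclidean_space) powr (- b - DIM('a))) \<partial>lborel)
       = ennreal (DIM('a) * unit_ball_vol DIM('a) * (\<delta> powr - b / b))"
proof -
  have [measurable]: "ball (0::'a) 1 \<in> sets borel" by simp
  have V: "(\<integral>\<^sup>+h. 1 * indicator (ball (0::'a) 1) h \<partial>lborel) = ennreal (unit_ball_vol DIM('a))"
    by (simp add: emeasure_ball)
  have fin: "(\<integral>\<^sup>+h. 1 * indicator (ball (0::'a) 1) h \<partial>lborel) < \<infinity>"
    unfolding V by simp
  have "(\<integral>\<^sup>+h\<in>- ball 0 \<delta>. ennreal (norm (h::'a) powr (- b - DIM('a))) \<partial>lborel)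
     = (\<integral>\<^sup>+h. 1 * (ennreal (norm (h::'a) powr (- b - DIM('a))) * indicator {\<delta>..} (norm h)) \<partial>lborel)"
    by (intro nn_integral_cong) (simp add: indicator_def)
  also have "\<dots> = ennreal DIM('a) * ennreal (unit_ball_vol DIM('a)) * ennreal (\<delta> powr - b / b)"
    using radial_powr_near_infinity[OF \<open>0 < b\<close> \<open>0 < \<delta>\<close> DIM_positive[where 'a='a]]
    by (subst nn_integral_homogeneous_times_radial[of "\<lambda>_. 1" "\<lambda>r. ennreal (r powr (- b - DIM('a))) * indicator {\<delta>..} r", OF _ _ refl fin])
       (auto simp: emeasure_ball)
  also have "\<dots> = ennreal (DIM('a) * unit_ball_vol DIM('a) * (\<delta> powr - b / b))"
    using assms by (simp add: ennreal_mult'[symmetric] mult.assoc)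
  finally show ?thesis .
qed

text \<open>
  The weights \<open>(1 - s) \<bar>h\<bar>\<close> to the power \<open>(1 - s) p - N\<close> form an approximate identity as \<open>s\<close>
  tends to 1, so only the behaviour of \<open>Q\<close> at the origin counts, and there \<open>Q\<close> looks like \<open>Q0\<close>. As
  \<open>Q0\<close> is constant on rays but may vary with the direction, \<open>Q\<close> need not have a limit at 0, and the
  answer is an integral of \<open>Q0\<close> over all directions. The bound on \<open>Q\<close> away from the origin makes
  the weighted integral outside a ball bounded for \<open>s\<close> near 1.
\<close>

lemma concentration_at_zero:
  fixes Q Q0 :: "'a::euclidean_space \<Rightarrow> ennreal" and p C :: real
  assumes [measurable]: "Q \<in> borel_measurable borel" "Q0 \<in> borel_measurable borel"
    and p: "0 < p" and C: "0 \<le> C"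
    and hom: "\<And>t h. 0 < t \<Longrightarrow> Q0 (t *\<^sub>R h) = Q0 h"
    and bdd: "\<And>h. Q0 h \<le> ennreal C"
    and far: "\<And>h. h \<noteq> 0 \<Longrightarrow> Q h \<le> ennreal (C * norm h powr - p)"
    and near: "\<And>e. 0 < e \<Longrightarrow> \<exists>\<delta>>0. \<forall>h. h \<noteq> 0 \<longrightarrow> norm h < \<delta> \<longrightarrow> Q h \<le> Q0 h + ennreal e \<and> Q0 h \<le> Q h + ennreal e"
  shows "((\<lambda>s. ennreal (1 - s) * (\<integral>\<^sup>+h. Q h * ennreal (norm h powr ((1 - s) * p - DIM('a))) \<partial>lborel))
     \<longlongrightarrow> ennreal (DIM('a) / p) * (\<integral>\<^sup>+h. Q0 h * indicator (ball 0 1) h \<partial>lborel)) (at_left 1)"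
proof -
  define M where "M = (\<integral>\<^sup>+h. Q0 h * indicator (ball 0 1) h \<partial>lborel)"
  define V where "V = unit_ball_vol DIM('a)"
  define n where "n = real DIM('a)"
  define c where "c = n * V / p"
  have n: "0 < n" and V: "0 < V" and c: "0 < c" using p by (simp_all add: n_def V_def c_def)
  have [measurable]: "ball (0::'a) r \<in> sets borel" for r by simp
  have vol: "(\<integral>\<^sup>+h. ennreal e * indicator (ball (0::'a) 1) h \<partial>lborel) = ennreal (e * V)" if "0 \<le> e" for e
    using that by (subst nn_integral_cmult_indicator) (auto simp: emeasure_ball V_def ennreal_mult')
  have "M \<le> (\<integral>\<^sup>+h. ennreal C * indicator (ball (0::'a) 1) h \<partial>lborel)"
    unfolding M_def by (intro nn_integral_mono mult_right_mono bdd) simp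
  also have "\<dots> < \<infinity>" using C by (simp add: vol)
  finally have fin: "(\<integral>\<^sup>+h. Q0 h * indicator (ball 0 1) h \<partial>lborel) < \<infinity>" by (simp add: M_def)
  then obtain M' where M': "M = ennreal M'" "0 \<le> M'" by (cases M) (auto simp: M_def)
  define m where "m = n / p * M'"
  have m: "0 \<le> m" using p n M' by (simp add: m_def)
  define F where "F = (\<lambda>s. ennreal (1 - s) * (\<integral>\<^sup>+h. Q h * ennreal (norm h powr ((1 - s) * p - n)) \<partial>lborel))"
  \<comment> \<open>the radial integral is \<open>\<delta> powr ((1 - s) * p) / ((1 - s) * p)\<close>, and its pole at \<open>s = 1\<close> cancels the factor \<open>1 - s\<close>\<close>
  have near_Q0: "ennreal (1 - s) * (\<integral>\<^sup>+h\<in>ball 0 \<delta>. Q0 h * ennreal (norm h powr ((1 - s) * p - n)) \<partial>lborel)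
      = ennreal (m * \<delta> powr ((1 - s) * p))" if "s < 1" "0 < \<delta>" for s \<delta>
  proof -
    have "(\<integral>\<^sup>+h\<in>ball 0 \<delta>. Q0 h * ennreal (norm h powr ((1 - s) * p - n)) \<partial>lborel)
       = ennreal n * M * ennreal (\<delta> powr ((1 - s) * p) / ((1 - s) * p))"
      unfolding M_def n_def using that p by (intro nn_integral_homogeneous_near_zero hom fin) auto
    also have "\<dots> = ennreal (n * M' * (\<delta> powr ((1 - s) * p) / ((1 - s) * p)))"
      using that p n M' by (simp add: ennreal_mult'[symmetric] mult.assoc)
    finally show ?thesis using that p by (simp add: ennreal_mult'[symmetric] m_def)
  qed
  have near_const: "ennreal (1 - s) * (\<integral>\<^sup>+h\<in>ball (0::'a) \<delta>. ennreal e * ennreal (norm h powr ((1 - s) * p - n)) \<partial>lborel)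
      = ennreal (e * c * \<delta> powr ((1 - s) * p))" if "s < 1" "0 < \<delta>" "0 \<le> e" for s \<delta> e
  proof -
    have "(\<integral>\<^sup>+h\<in>ball (0::'a) \<delta>. ennreal e * ennreal (norm h powr ((1 - s) * p - n)) \<partial>lborel)
       = ennreal n * (\<integral>\<^sup>+h. ennreal e * indicator (ball (0::'a) 1) h \<partial>lborel) * ennreal (\<delta> powr ((1 - s) * p) / ((1 - s) * p))"
      unfolding n_def using that p by (intro nn_integral_homogeneous_near_zero) (auto simp: vol)
    also have "\<dots> = ennreal (n * (e * V) * (\<delta> powr ((1 - s) * p) / ((1 - s) * p)))"
      using that p n V by (simp add: vol ennreal_mult'[symmetric] mult.assoc)
    finally show ?thesis using that p by (simp add: ennreal_mult'[symmetric] c_def mult_ac)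
  qed
  have far_Q: "ennreal (1 - s) * (\<integral>\<^sup>+h\<in>- ball (0::'a) \<delta>. ennreal (C * norm h powr - p) * ennreal (norm h powr ((1 - s) * p - n)) \<partial>lborel)
      = ennreal ((1 - s) * (C * (n * V * (\<delta> powr - (s * p) / (s * p)))))" if "s < 1" "0 < \<delta>" "0 < s" for s \<delta>
  proof -
    have "(\<integral>\<^sup>+h\<in>- ball (0::'a) \<delta>. ennreal (C * norm h powr - p) * ennreal (norm h powr ((1 - s) * p - n)) \<partial>lborel)
       = (\<integral>\<^sup>+h. ennreal C * (ennreal (norm h powr (- (s * p) - n)) * indicator (- ball (0::'a) \<delta>) h) \<partial>lborel)"
    proof (intro nn_integral_cong)
      fix h :: 'a
      have "norm h powr - p * norm h powr ((1 - s) * p - n) = norm h powr (- (s * p) - n)"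
        by (simp add: powr_add[symmetric] algebra_simps minus_diff_commute)
      then show "ennreal (C * norm h powr - p) * ennreal (norm h powr ((1 - s) * p - n)) * indicator (- ball 0 \<delta>) h
          = ennreal C * (ennreal (norm h powr (- (s * p) - n)) * indicator (- ball 0 \<delta>) h)"
        using C by (simp add: ennreal_mult'[symmetric] mult.assoc[symmetric]) (simp add: mult.assoc)
    qed
    also have "\<dots> = ennreal C * ennreal (n * V * (\<delta> powr - (s * p) / (s * p)))"
      unfolding n_def V_def using that p
      by (subst nn_integral_cmult) (simp_all add: nn_integral_powr_near_infinity)
    finally show ?thesis using that p C n V by (simp add: ennreal_mult'[symmetric])
  qed
  have "(F \<longlongrightarrow> ennreal m) (at_left 1)"
  proof (rule tendsto_ennreal_bounds[OF m])
    fix e :: real assume e: "0 < e"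
    define e' where "e' = e / (2 * c)"
    have e': "0 < e'" "e' * c = e / 2" using e c by (simp_all add: e'_def)
    obtain d where d: "0 < d" "\<And>h. h \<noteq> 0 \<Longrightarrow> norm h < d \<Longrightarrow> Q h \<le> Q0 h + ennreal e' \<and> Q0 h \<le> Q h + ennreal e'"
      using near[OF e'(1)] by blast
    \<comment> \<open>a radius of at most 1 keeps \<open>\<delta> powr ((1 - s) * p)\<close> below its limit 1, as the lower bound requires\<close>
    define \<delta> where "\<delta> = min d 1"
    have \<delta>: "0 < \<delta>" "\<delta> \<le> 1" "\<And>h. h \<noteq> 0 \<Longrightarrow> h \<in> ball 0 \<delta> \<Longrightarrow> Q h \<le> Q0 h + ennreal e' \<and> Q0 h \<le> Q h + ennreal e'"
      using d by (auto simp: \<delta>_def)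
    define U where "U = (\<lambda>s. (m + e / 2) * \<delta> powr ((1 - s) * p) + (1 - s) * (C * (n * V * (\<delta> powr - (s * p) / (s * p)))))"
    have "(U \<longlongrightarrow> (m + e / 2) * \<delta> powr ((1 - 1) * p) + (1 - 1) * (C * (n * V * (\<delta> powr - (1 * p) / (1 * p))))) (at_left 1)"
      unfolding U_def using \<delta> p by (intro tendsto_intros) auto
    then have "(U \<longlongrightarrow> m + e / 2) (at_left 1)" using \<delta> by simp
    then have U: "eventually (\<lambda>s. U s < m + e) (at_left 1)"
      by (rule order_tendstoD) (use e in simp)
    have "((\<lambda>s. m - m * \<delta> powr ((1 - s) * p)) \<longlongrightarrow> m - m * \<delta> powr ((1 - 1) * p)) (at_left 1)"
      using \<delta> by (intro tendsto_intros) auto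
    then have L: "eventually (\<lambda>s. m - m * \<delta> powr ((1 - s) * p) < e / 2) (at_left 1)"
      by (rule order_tendstoD) (use e \<delta> in simp)
    have "eventually (\<lambda>s. s \<in> {0<..<1}) (at_left (1::real))"
      by (rule eventually_at_left_real) simp
    with U L show "eventually (\<lambda>s. F s \<le> ennreal (m + e) \<and> ennreal m \<le> F s + ennreal e) (at_left 1)"
    proof eventually_elim
      case (elim s)
      then have s: "0 < s" "s < 1" by auto
      let ?w = "\<lambda>h::'a. ennreal (norm h powr ((1 - s) * p - n))"
      have "(\<integral>\<^sup>+h. Q h * ?w h \<partial>lborel)
          \<le> (\<integral>\<^sup>+h. (Q0 h * ?w h * indicator (ball 0 \<delta>) h + ennreal e' * ?w h * indicator (ball 0 \<delta>) h)
               + ennreal (C * norm h powr - p) * ?w h * indicator (- ball 0 \<delta>) h \<partial>lborel)"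
      proof (rule nn_integral_mono_AE, use AE_lborel_singleton[of "0::'a"] in eventually_elim)
        case (elim h)
        then show ?case
          using \<delta>(3)[OF elim] far[OF elim]
          by (cases "h \<in> ball 0 \<delta>") (auto simp: distrib_right[symmetric] intro!: mult_right_mono)
      qed
      also have "\<dots> = (\<integral>\<^sup>+h\<in>ball 0 \<delta>. Q0 h * ?w h \<partial>lborel) + (\<integral>\<^sup>+h\<in>ball 0 \<delta>. ennreal e' * ?w h \<partial>lborel)
             + (\<integral>\<^sup>+h\<in>- ball 0 \<delta>. ennreal (C * norm h powr - p) * ?w h \<partial>lborel)"
        by (subst nn_integral_add, simp, simp, subst nn_integral_add) auto
      finally have "F s \<le> ennreal (1 - s) * \<dots>" unfolding F_def by (rule mult_left_mono) simp
      also have "\<dots> = ennreal (U s)"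
        using s \<delta> e' m c n V C e p unfolding distrib_left
        by (simp add: near_Q0 near_const far_Q U_def ennreal_plus[symmetric] distrib_right del: ennreal_plus)
      also have "\<dots> \<le> ennreal (m + e)" using elim by (intro ennreal_leI) simp
      finally have up: "F s \<le> ennreal (m + e)" .
      have "(\<integral>\<^sup>+h\<in>ball 0 \<delta>. Q0 h * ?w h \<partial>lborel) \<le> (\<integral>\<^sup>+h. Q h * ?w h + ennreal e' * ?w h * indicator (ball 0 \<delta>) h \<partial>lborel)"
      proof (rule nn_integral_mono_AE, use AE_lborel_singleton[of "0::'a"] in eventually_elim)
        case (elim h)
        then show ?case
          using \<delta>(3)[OF elim]
          by (cases "h \<in> ball 0 \<delta>") (auto simp: distrib_right[symmetric] intro!: mult_right_mono)
      qed
      also have "\<dots> = (\<integral>\<^sup>+h. Q h * ?w h \<partial>lborel) + (\<integral>\<^sup>+h\<in>ball 0 \<delta>. ennreal e' * ?w h \<partial>lborel)"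
        by (rule nn_integral_add) auto
      finally have "ennreal (1 - s) * (\<integral>\<^sup>+h\<in>ball 0 \<delta>. Q0 h * ?w h \<partial>lborel) \<le> ennreal (1 - s) * \<dots>"
        by (rule mult_left_mono) simp
      also have "\<dots> = F s + ennreal (e / 2 * \<delta> powr ((1 - s) * p))"
        by (simp only: distrib_left near_const[OF s(2) \<delta>(1) less_imp_le[OF e'(1)]] e'(2) F_def)
      also have "\<dots> \<le> F s + ennreal (e / 2)"
      proof (intro add_left_mono ennreal_leI)
        have "\<delta> powr ((1 - s) * p) \<le> 1 powr ((1 - s) * p)"
          using s \<delta> p by (intro powr_mono2) auto
        then show "e / 2 * \<delta> powr ((1 - s) * p) \<le> e / 2" using e by simp
      qed
      finally have "ennreal (m * \<delta> powr ((1 - s) * p)) \<le> F s + ennreal (e / 2)"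
        using s \<delta> by (simp add: near_Q0)
      then have "ennreal (m * \<delta> powr ((1 - s) * p)) + ennreal (e / 2) \<le> F s + ennreal (e / 2) + ennreal (e / 2)"
        by (rule add_right_mono)
      also have "\<dots> = F s + ennreal e"
        using e unfolding add.assoc by (subst ennreal_plus[symmetric]) auto
      finally have "ennreal (m * \<delta> powr ((1 - s) * p) + e / 2) \<le> F s + ennreal e"
        using m e by simp
      moreover have "ennreal m \<le> ennreal (m * \<delta> powr ((1 - s) * p) + e / 2)"
        using elim by (intro ennreal_leI) simp
      ultimately show ?case using up by (auto intro: order_trans)
    qed
  qed
  moreover have "ennreal (n / p) * M = ennreal m"
    using n p M' by (simp add: m_def ennreal_mult'[symmetric])
  ultimately have "(F \<longlongrightarrow> ennreal (n / p) * M) (at_left 1)" by (simp only:)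
  then show ?thesis unfolding F_def M_def n_def .
qed

section \<open>Differentiability up to the boundary\<close>

lemma convex_closed_half_space: "convex (closed_half_space :: ((real ^ 'n) \<times> real) set)"
  unfolding closed_half_space_def by (intro convex_Times) auto

lemma closed_closed_half_space: "closed (closed_half_space :: ((real ^ 'n) \<times> real) set)"
  unfolding closed_half_space_def by (intro closed_Times) auto

lemma has_derivative_half_space_gradient:
  fixes u :: "(real ^ 'n) \<times> real \<Rightarrow> real"
  assumes "u differentiable (at x within closed_half_space)"
  shows "(u has_derivative (\<lambda>h. half_space_gradient u x \<bullet> h)) (at x within closed_half_space)"
proof -
  define f where "f = frechet_derivative u (at x within closed_half_space)"
  have d: "(u has_derivative f) (at x within closed_half_space)"
    unfolding f_def using assms by (simp add: frechet_derivative_works)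
  then have lin: "linear f" by (rule has_derivative_linear)
  have "f h = half_space_gradient u x \<bullet> h" for h
  proof -
    have "f h = f (\<Sum>b\<in>Basis. (h \<bullet> b) *\<^sub>R b)" by (simp add: euclidean_representation)
    also have "\<dots> = (\<Sum>b\<in>Basis. (h \<bullet> b) *\<^sub>R f b)"
      by (simp add: linear_sum[OF lin] linear_scale[OF lin] o_def)
    also have "\<dots> = half_space_gradient u x \<bullet> h"
      by (simp add: half_space_gradient_def f_def[symmetric] inner_sum_right inner_commute[of _ h] mult.commute)
    finally show ?thesis .
  qed
  then have "f = (\<lambda>h. half_space_gradient u x \<bullet> h)" by auto
  with d show ?thesis by simp
qed

text \<open>
  The derivative within the closed half-space is unique even at boundary points, because the
  half-space can be entered from each of its points along the positive coordinate directions.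
\<close>

lemma half_space_gradient_eq_0:
  fixes u :: "(real ^ 'n) \<times> real \<Rightarrow> real"
  assumes x: "x \<in> closed_half_space" and "0 < e"
    and zero: "\<And>y. y \<in> closed_half_space \<Longrightarrow> dist y x < e \<Longrightarrow> u y = 0"
  shows "half_space_gradient u x = 0"
proof -
  have 0: "(u has_derivative (\<lambda>_. 0)) (at x within closed_half_space)"
  proof (rule has_derivative_transform_within[of "\<lambda>_. 0", OF _ \<open>0 < e\<close> x])
    show "0 = u y" if "y \<in> closed_half_space" "dist y x < e" for y using zero[OF that] by simp
  qed simp
  then have "u differentiable (at x within closed_half_space)" by (auto simp: differentiable_def)
  then have "(u has_derivative (\<lambda>h. half_space_gradient u x \<bullet> h)) (at x within closed_half_space)"
    by (rule has_derivative_half_space_gradient)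
  with 0 have eq: "(\<lambda>_. 0) = (\<lambda>h. half_space_gradient u x \<bullet> h)"
  proof (rule frechet_derivative_unique_within)
    fix i :: "(real ^ 'n) \<times> real" and d :: real assume "i \<in> Basis" "0 < d"
    then have "0 \<le> snd i" by (auto simp: Basis_prod_def)
    with x \<open>0 < d\<close> have "x + (d / 2) *\<^sub>R i \<in> closed_half_space"
      by (auto simp: closed_half_space_def mem_Times_iff)
    with \<open>0 < d\<close> show "\<exists>t. 0 < \<bar>t\<bar> \<and> \<bar>t\<bar> < d \<and> x + t *\<^sub>R i \<in> closed_half_space"
      by (intro exI[of _ "d / 2"]) auto
  qed
  from fun_cong[OF eq, of "half_space_gradient u x"] show ?thesis by simp
qed

lemma onorm_inner_le: "onorm (\<lambda>h. a \<bullet> h) \<le> norm (a :: 'a::real_inner)"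
  by (rule onorm_bound) (auto simp: Cauchy_Schwarz_ineq2)

lemma C1c_half_space_bounds:
  fixes u :: "(real ^ 'n) \<times> real \<Rightarrow> real"
  assumes u: "u \<in> C1c_closed_half_space"
  obtains R L U where "0 < R" "0 \<le> L" "0 \<le> U"
    and "\<And>x. x \<in> closed_half_space \<Longrightarrow> R \<le> norm x \<Longrightarrow> u x = 0"
    and "\<And>x. x \<in> closed_half_space \<Longrightarrow> R \<le> norm x \<Longrightarrow> half_space_gradient u x = 0"
    and "\<And>x. x \<in> closed_half_space \<Longrightarrow> norm (half_space_gradient u x) \<le> L"
    and "\<And>x. x \<in> closed_half_space \<Longrightarrow> \<bar>u x\<bar> \<le> U"
    and "\<And>x y. x \<in> closed_half_space \<Longrightarrow> y \<in> closed_half_space \<Longrightarrow> \<bar>u x - u y\<bar> \<le> L * norm (x - y)"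
proof -
  let ?H = "closed_half_space :: ((real ^ 'n) \<times> real) set"
  let ?g = "half_space_gradient u"
  have diff: "\<And>x. x \<in> ?H \<Longrightarrow> (u has_derivative (\<lambda>h. ?g x \<bullet> h)) (at x within ?H)"
    using u by (intro has_derivative_half_space_gradient) (auto simp: C1c_closed_half_space_def differentiable_on_def)
  have cont: "continuous_on ?H u" "continuous_on ?H ?g"
    using u by (auto simp: C1c_closed_half_space_def differentiable_imp_continuous_on)
  have "bounded {x \<in> ?H. u x \<noteq> 0}"
    using u by (auto simp: C1c_closed_half_space_def intro: bounded_subset[OF compact_imp_bounded closure_subset])
  then obtain R0 where R0: "\<And>x. x \<in> ?H \<Longrightarrow> u x \<noteq> 0 \<Longrightarrow> norm x \<le> R0" unfolding bounded_iff by blast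
  define R where "R = \<bar>R0\<bar> + 1"
  have R: "0 < R" "R0 < R" by (auto simp: R_def)
  have u0: "u x = 0" if "x \<in> ?H" "R \<le> norm x" for x
    using R0[OF that(1)] that(2) R by force
  have g0: "?g x = 0" if "x \<in> ?H" "R \<le> norm x" for x
  proof (rule half_space_gradient_eq_0[OF that(1)])
    show "0 < R - R0" using R by simp
    show "u y = 0" if y: "y \<in> ?H" "dist y x < R - R0" for y
    proof (rule ccontr)
      assume "u y \<noteq> 0"
      with R0 y have "norm y \<le> R0" by blast
      moreover have "norm x \<le> norm y + dist y x"
        using norm_triangle_sub[of x y] by (simp add: dist_norm norm_minus_commute)
      ultimately show False using y \<open>R \<le> norm x\<close> by simp
    qed
  qed
  have comp: "compact (cball 0 R \<inter> ?H)"
    by (intro compact_Int_closed compact_cball closed_closed_half_space)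
  have "compact (?g ` (cball 0 R \<inter> ?H))" "compact (u ` (cball 0 R \<inter> ?H))"
    by (intro compact_continuous_image comp continuous_on_subset[OF cont(2)] continuous_on_subset[OF cont(1)]; auto)+
  then obtain L U where LU: "0 < L" "0 < U" "\<And>x. x \<in> cball 0 R \<inter> ?H \<Longrightarrow> norm (?g x) \<le> L" "\<And>x. x \<in> cball 0 R \<inter> ?H \<Longrightarrow> norm (u x) \<le> U"
    by (metis (no_types, lifting) bounded_pos compact_imp_bounded imageI)
  have L: "norm (?g x) \<le> L" if "x \<in> ?H" for x
    using LU g0[OF that] that by (cases "norm x \<le> R") auto
  have U: "\<bar>u x\<bar> \<le> U" if "x \<in> ?H" for x
    using LU u0[OF that] that by (cases "norm x \<le> R") auto
  have "\<bar>u x - u y\<bar> \<le> L * norm (x - y)" if "x \<in> ?H" "y \<in> ?H" for x y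
    using differentiable_bound[OF convex_closed_half_space diff _ that, of L] order_trans[OF onorm_inner_le L]
    by simp
  with that[OF R(1), of L U] LU(1,2) u0 g0 L U show ?thesis by (simp add: less_imp_le)
qed

text \<open>
  The mean value inequality for \<open>y \<mapsto> u y - Du(x) \<bullet> y\<close> on the convex set of points of the half-space
  near \<open>x\<close>. The modulus does not depend on \<open>x\<close>, since the gradient is uniformly continuous: on a ball
  by compactness, and beyond because it vanishes there.
\<close>

lemma uniformly_differentiable_half_space:
  fixes u :: "(real ^ 'n) \<times> real \<Rightarrow> real"
  assumes u: "u \<in> C1c_closed_half_space" and e: "0 < e"
  obtains \<delta> where "0 < \<delta>" "\<And>x h. x \<in> closed_half_space \<Longrightarrow> x + h \<in> closed_half_space \<Longrightarrow> norm h < \<delta> \<Longrightarrow>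
     \<bar>u (x + h) - u x - half_space_gradient u x \<bullet> h\<bar> \<le> e * norm h"
proof -
  let ?H = "closed_half_space :: ((real ^ 'n) \<times> real) set"
  let ?g = "half_space_gradient u"
  have diff: "\<And>x. x \<in> ?H \<Longrightarrow> (u has_derivative (\<lambda>h. ?g x \<bullet> h)) (at x within ?H)"
    using u by (intro has_derivative_half_space_gradient) (auto simp: C1c_closed_half_space_def differentiable_on_def)
  have cont: "continuous_on ?H ?g" using u by (auto simp: C1c_closed_half_space_def)
  obtain R where g0: "\<And>x. x \<in> ?H \<Longrightarrow> R \<le> norm x \<Longrightarrow> ?g x = 0"
    using C1c_half_space_bounds[OF u] by metis
  \<comment> \<open>the margin 1 ensures that if one of two points at distance less than 1 is outside this ball, then the gradient vanishes at both\<close>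
  have "compact (cball 0 (R + 1) \<inter> ?H)"
    by (intro compact_Int_closed compact_cball closed_closed_half_space)
  then have "uniformly_continuous_on (cball 0 (R + 1) \<inter> ?H) ?g"
    by (intro compact_uniformly_continuous continuous_on_subset[OF cont]) auto
  then obtain d where d: "0 < d" "\<And>x y. x \<in> cball 0 (R + 1) \<inter> ?H \<Longrightarrow> y \<in> cball 0 (R + 1) \<inter> ?H \<Longrightarrow> dist y x < d \<Longrightarrow> dist (?g y) (?g x) < e"
    using e unfolding uniformly_continuous_on_def by metis
  define \<delta> where "\<delta> = min d 1"
  have \<delta>: "0 < \<delta>" "\<delta> \<le> 1" "\<delta> \<le> d" using d by (auto simp: \<delta>_def)
  have unif: "norm (?g y - ?g x) \<le> e" if "x \<in> ?H" "y \<in> ?H" "dist y x < \<delta>" for x y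
  proof (cases "norm x \<le> R + 1 \<and> norm y \<le> R + 1")
    case True
    then show ?thesis using d(2)[of x y] that \<delta> by (simp add: dist_norm)
  next
    case False
    have "norm x \<le> norm y + dist y x" "norm y \<le> norm x + dist y x"
      using norm_triangle_sub[of x y] norm_triangle_sub[of y x] by (simp_all add: dist_norm norm_minus_commute)
    then have "?g x = 0" "?g y = 0" using False that \<delta> by (auto intro!: g0)
    then show ?thesis using e by simp
  qed
  show ?thesis
  proof (rule that[OF \<delta>(1)])
    fix x h :: "(real ^ 'n) \<times> real" assume x: "x \<in> ?H" "x + h \<in> ?H" "norm h < \<delta>"
    define S where "S = ball x \<delta> \<inter> ?H"
    have "norm ((u (x + h) - ?g x \<bullet> (x + h)) - (u x - ?g x \<bullet> x)) \<le> e * norm (x + h - x)"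
    proof (rule differentiable_bound[where S = S and f' = "\<lambda>y h. (?g y - ?g x) \<bullet> h"])
      show "convex S" unfolding S_def by (intro convex_Int convex_ball convex_closed_half_space)
      show "((\<lambda>y. u y - ?g x \<bullet> y) has_derivative (\<lambda>h. (?g y - ?g x) \<bullet> h)) (at y within S)" if "y \<in> S" for y
        unfolding inner_diff_left using that
        by (intro derivative_intros has_derivative_subset[OF diff]) (auto simp: S_def)
      show "onorm (\<lambda>h. (?g y - ?g x) \<bullet> h) \<le> e" if "y \<in> S" for y
        using that x unif[of x y] order_trans[OF onorm_inner_le] by (auto simp: S_def dist_commute)
      show "x + h \<in> S" "x \<in> S" using x \<delta> by (auto simp: S_def dist_norm)
    qed
    then show "\<bar>u (x + h) - u x - ?g x \<bullet> h\<bar> \<le> e * norm h"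
      by (simp add: inner_add_right algebra_simps)
  qed
qed

section \<open>Difference quotients at boundary points\<close>

lemma open_half_space_eq: "open_half_space = {h :: (real ^ 'n) \<times> real. 0 < (0, 1) \<bullet> h}"
  by (auto simp: open_half_space_def inner_prod_def)

lemma boundary_in_closed_half_space: "(x, 0) \<in> closed_half_space"
  by (simp add: closed_half_space_def)

lemma boundary_plus_open_half_space: "h \<in> open_half_space \<Longrightarrow> (x, 0) + h \<in> closed_half_space"
  by (auto simp: open_half_space_def closed_half_space_def mem_Times_iff)

definition difference_quotient :: "((real ^ 'n) \<times> real \<Rightarrow> real) \<Rightarrow> real ^ 'n \<Rightarrow> (real ^ 'n) \<times> real \<Rightarrow> real" where
  "difference_quotient u x h = \<bar>u (x, 0) - u ((x, 0) + h)\<bar> / norm h"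

definition directional_slope :: "((real ^ 'n) \<times> real \<Rightarrow> real) \<Rightarrow> real ^ 'n \<Rightarrow> (real ^ 'n) \<times> real \<Rightarrow> real" where
  "directional_slope u x h = \<bar>half_space_gradient u (x, 0) \<bullet> h\<bar> / norm h"

text \<open>
  Nothing is known about \<open>u\<close> outside the closed half-space, so \<open>u\<close> itself need not be measurable. The
  indicator restricts attention to increments \<open>h\<close> for which both points lie in the closed half-space,
  and there \<open>u\<close> may be replaced by its extension by 0.
\<close>

lemma borel_measurable_difference_quotient [measurable]:
  fixes u :: "(real ^ 'n) \<times> real \<Rightarrow> real"
  assumes u: "u \<in> C1c_closed_half_space"
  shows "(\<lambda>(x, h). ennreal (difference_quotient u x h powr p) * indicator open_half_space h) \<in> borel_measurable (borel \<Otimes>\<^sub>M borel)"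
proof -
  define v where "v = (\<lambda>z. indicator closed_half_space z *\<^sub>R u z)"
  have "continuous_on closed_half_space u"
    using u by (auto simp: C1c_closed_half_space_def differentiable_imp_continuous_on)
  then have v[measurable]: "v \<in> borel_measurable borel"
    unfolding v_def using closed_closed_half_space
    by (intro borel_measurable_continuous_on_indicator) (auto intro: borel_closed)
  have [measurable]: "open_half_space \<in> sets (borel :: ((real ^ 'n) \<times> real) measure)"
    unfolding open_half_space_def by (intro borel_open open_Times) auto
  have "(\<lambda>(x, h). ennreal ((\<bar>v (x, 0) - v ((x, 0) + h)\<bar> / norm h) powr p) * indicator open_half_space h)
      \<in> borel_measurable (borel \<Otimes>\<^sub>M borel)"
  proof -
    have [measurable]: "(\<lambda>z. (fst z :: real ^ 'n, 0::real)) \<in> borel_measurable (borel \<Otimes>\<^sub>M (borel :: ((real ^ 'n) \<times> real) measure))"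
      by (rule borel_measurable_Pair) measurable
    show ?thesis by measurable
  qed
  also have "(\<lambda>(x, h). ennreal ((\<bar>v (x, 0) - v ((x, 0) + h)\<bar> / norm h) powr p) * indicator open_half_space h)
     = (\<lambda>(x, h). ennreal (difference_quotient u x h powr p) * indicator open_half_space h)"
  proof (rule ext)
    fix z :: "(real ^ 'n) \<times> ((real ^ 'n) \<times> real)"
    obtain x h where z: "z = (x, h)" by (cases z)
    show "(case z of (x, h) \<Rightarrow> ennreal ((\<bar>v (x, 0) - v ((x, 0) + h)\<bar> / norm h) powr p) * indicator open_half_space h)
        = (case z of (x, h) \<Rightarrow> ennreal (difference_quotient u x h powr p) * indicator open_half_space h)"
      using boundary_in_closed_half_space[of x] boundary_plus_open_half_space[of h x]
      by (cases "h \<in> open_half_space") (simp_all add: z v_def difference_quotient_def)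
  qed
  finally show ?thesis .
qed

lemma borel_measurable_boundary_gradient:
  fixes u :: "(real ^ 'n) \<times> real \<Rightarrow> real"
  assumes u: "u \<in> C1c_closed_half_space"
  shows "(\<lambda>x. half_space_gradient u (x, 0)) \<in> borel_measurable borel"
proof -
  have "continuous_on closed_half_space (half_space_gradient u)"
    using u by (auto simp: C1c_closed_half_space_def)
  then have "continuous_on UNIV (\<lambda>x. half_space_gradient u (x, 0))"
    by (rule continuous_on_compose2) (auto intro!: continuous_intros simp: boundary_in_closed_half_space)
  then show ?thesis by (rule borel_measurable_continuous_onI)
qed

lemma borel_measurable_directional_slope [measurable]:
  fixes u :: "(real ^ 'n) \<times> real \<Rightarrow> real"
  assumes u: "u \<in> C1c_closed_half_space"
  shows "(\<lambda>(x, h). ennreal (directional_slope u x h powr p) * indicator open_half_space h) \<in> borel_measurable (borel \<Otimes>\<^sub>M borel)"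
proof -
  note [measurable] = borel_measurable_boundary_gradient[OF u]
  have [measurable]: "open_half_space \<in> sets (borel :: ((real ^ 'n) \<times> real) measure)"
    unfolding open_half_space_def by (intro borel_open open_Times) auto
  show ?thesis unfolding directional_slope_def by measurable
qed

lemma directional_slope_le: "directional_slope u x h \<le> norm (half_space_gradient u (x, 0))"
  using Cauchy_Schwarz_ineq2[of "half_space_gradient u (x, 0)" h]
  by (cases "h = 0") (auto simp: directional_slope_def field_simps)

lemma powr_uniformly_continuous:
  fixes p L e :: real
  assumes "0 < p" "0 < e"
  obtains \<epsilon> where "0 < \<epsilon>" "\<And>\<alpha> \<beta>. \<alpha> \<in> {0..L} \<Longrightarrow> \<beta> \<in> {0..L} \<Longrightarrow> \<bar>\<alpha> - \<beta>\<bar> < \<epsilon> \<Longrightarrow> \<bar>\<alpha> powr p - \<beta> powr p\<bar> < e"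
proof -
  have "continuous_on {0..L} (\<lambda>t. t powr p)"
    using assms by (intro continuous_on_powr' continuous_intros) auto
  then have "uniformly_continuous_on {0..L} (\<lambda>t. t powr p)"
    by (rule compact_uniformly_continuous) simp
  then show ?thesis
    using assms that unfolding uniformly_continuous_on_def by (metis dist_real_def)
qed

text \<open>
  The two quotients themselves are uniformly close by uniform differentiability; as both lie in
  \<open>{0..L}\<close>, uniform continuity of the power on this interval carries this over to the powers.
\<close>

lemma difference_quotient_tendsto_uniformly:
  fixes u :: "(real ^ 'n) \<times> real \<Rightarrow> real" and p e :: real
  assumes u: "u \<in> C1c_closed_half_space" and p: "0 < p" and e: "0 < e"
  obtains \<delta> where "0 < \<delta>"
    "\<And>x h. h \<in> open_half_space \<Longrightarrow> norm h < \<delta> \<Longrightarrow> \<bar>difference_quotient u x h powr p - directional_slope u x h powr p\<bar> \<le> e"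
proof -
  obtain L where L: "\<And>x. x \<in> closed_half_space \<Longrightarrow> norm (half_space_gradient u x) \<le> L"
      "\<And>x y. x \<in> closed_half_space \<Longrightarrow> y \<in> closed_half_space \<Longrightarrow> \<bar>u x - u y\<bar> \<le> L * norm (x - y)"
    using C1c_half_space_bounds[OF u] by metis
  obtain \<epsilon> where \<epsilon>: "0 < \<epsilon>" "\<And>\<alpha> \<beta>. \<alpha> \<in> {0..L} \<Longrightarrow> \<beta> \<in> {0..L} \<Longrightarrow> \<bar>\<alpha> - \<beta>\<bar> < \<epsilon> \<Longrightarrow> \<bar>\<alpha> powr p - \<beta> powr p\<bar> < e"
    using powr_uniformly_continuous[OF p e] by blast
  have "0 < \<epsilon> / 2" using \<epsilon> by simp
  then obtain \<delta> where \<delta>: "0 < \<delta>" "\<And>x h. x \<in> closed_half_space \<Longrightarrow> x + h \<in> closed_half_space \<Longrightarrow> norm h < \<delta> \<Longrightarrow>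
     \<bar>u (x + h) - u x - half_space_gradient u x \<bullet> h\<bar> \<le> \<epsilon> / 2 * norm h"
    using uniformly_differentiable_half_space[OF u] by blast
  show ?thesis
  proof (rule that[OF \<delta>(1)])
    fix x :: "real ^ 'n" and h :: "(real ^ 'n) \<times> real"
    assume h: "h \<in> open_half_space" "norm h < \<delta>"
    then have nh: "0 < norm h" by (auto simp: open_half_space_def zero_prod_def)
    let ?d = "u ((x, 0) + h) - u (x, 0)" and ?g = "half_space_gradient u (x, 0) \<bullet> h"
    note x = boundary_in_closed_half_space[of x] boundary_plus_open_half_space[OF h(1), of x]
    have "\<bar>?d\<bar> \<le> L * norm h" using L(2)[OF x(2,1)] by simp
    then have dq: "difference_quotient u x h \<in> {0..L}"
      using nh by (simp add: difference_quotient_def field_simps abs_minus_commute)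
    have ds: "directional_slope u x h \<in> {0..L}"
      using order_trans[OF directional_slope_le L(1)[OF x(1)]] by (simp add: directional_slope_def)
    have "\<bar>\<bar>?d\<bar> - \<bar>?g\<bar>\<bar> \<le> \<bar>?d - ?g\<bar>" by (rule abs_triangle_ineq3)
    also have "\<dots> \<le> \<epsilon> / 2 * norm h" using \<delta>(2)[OF x h(2)] by simp
    also have "\<dots> < \<epsilon> * norm h" using \<epsilon> nh by simp
    finally have "\<bar>\<bar>?d\<bar> - \<bar>?g\<bar>\<bar> / norm h < \<epsilon>" using nh by (simp add: field_simps)
    moreover have "\<bar>\<bar>?d\<bar> - \<bar>?g\<bar>\<bar> / norm h = \<bar>difference_quotient u x h - directional_slope u x h\<bar>"
      unfolding difference_quotient_def directional_slope_def diff_divide_distrib[symmetric]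
      by (simp add: abs_divide abs_minus_commute)
    ultimately show "\<bar>difference_quotient u x h powr p - directional_slope u x h powr p\<bar> \<le> e"
      using \<epsilon>(2)[OF dq ds] by simp
  qed
qed

lemma nn_integral_le_ball:
  fixes f :: "'a::euclidean_space \<Rightarrow> ennreal"
  assumes "\<And>x. f x \<le> ennreal c * indicator (ball z r) x" "0 \<le> r" "0 \<le> c"
  shows "(\<integral>\<^sup>+x. f x \<partial>lborel) \<le> ennreal (c * (unit_ball_vol DIM('a) * r ^ DIM('a)))"
proof -
  have "(\<integral>\<^sup>+x. f x \<partial>lborel) \<le> (\<integral>\<^sup>+x. ennreal c * indicator (ball z r) x \<partial>lborel)"
    by (rule nn_integral_mono) (rule assms)
  also have "\<dots> = ennreal (c * (unit_ball_vol DIM('a) * r ^ DIM('a)))"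
    using assms by (subst nn_integral_cmult_indicator) (auto simp: emeasure_ball ennreal_mult')
  finally show ?thesis .
qed

section \<open>Boundary averages\<close>

text \<open>
  Exchanging the two integrations turns the Gagliardo-type integral into an integral over \<open>h\<close> of
  one function of \<open>h\<close> alone, the average below, against a power of \<open>norm h\<close>. Its values outside the
  half-space are put to zero so that the remaining integral runs over the whole space, and the
  half-space only matters as a cone.
\<close>

definition difference_average :: "real \<Rightarrow> ((real ^ 'n) \<times> real \<Rightarrow> real) \<Rightarrow> (real ^ 'n) \<times> real \<Rightarrow> ennreal" where
  "difference_average p u h =
     (\<integral>\<^sup>+x. ennreal (difference_quotient u x h powr p) * indicator open_half_space h \<partial>lborel)"

definition slope_average :: "real \<Rightarrow> ((real ^ 'n) \<times> real \<Rightarrow> real) \<Rightarrow> (real ^ 'n) \<times> real \<Rightarrow> ennreal" where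
  "slope_average p u h =
     (\<integral>\<^sup>+x. ennreal (directional_slope u x h powr p) * indicator open_half_space h \<partial>lborel)"

lemma borel_measurable_averages:
  fixes u :: "(real ^ 'n) \<times> real \<Rightarrow> real"
  assumes u: "u \<in> C1c_closed_half_space"
  shows "difference_average p u \<in> borel_measurable borel"
    and "slope_average p u \<in> borel_measurable borel"
proof -
  note [measurable] = borel_measurable_difference_quotient[OF u, of p] borel_measurable_directional_slope[OF u, of p]
  have "(\<lambda>(h, x). ennreal (difference_quotient u x h powr p) * indicator open_half_space h) \<in> borel_measurable (borel \<Otimes>\<^sub>M lborel)"
       "(\<lambda>(h, x). ennreal (directional_slope u x h powr p) * indicator open_half_space h) \<in> borel_measurable (borel \<Otimes>\<^sub>M lborel)"
    by measurable
  from this[THEN lborel.borel_measurable_nn_integral]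
  show "difference_average p u \<in> borel_measurable borel" "slope_average p u \<in> borel_measurable borel"
    by (simp_all add: difference_average_def[abs_def] slope_average_def[abs_def])
qed

lemma slope_average_scaleR:
  assumes "0 < t"
  shows "slope_average p u (t *\<^sub>R h) = slope_average p u h"
  using assms
  by (simp add: slope_average_def directional_slope_def abs_mult indicator_def open_half_space_def mem_Times_iff zero_less_mult_iff)

lemma slope_average_bounded:
  fixes u :: "(real ^ 'n) \<times> real \<Rightarrow> real" and p :: real
  assumes u: "u \<in> C1c_closed_half_space" and p: "0 < p"
  obtains C where "0 \<le> C" "\<And>h. slope_average p u h \<le> ennreal C"
proof -
  obtain R L where R: "0 < R" "0 \<le> L"
    and g0: "\<And>x. x \<in> closed_half_space \<Longrightarrow> R \<le> norm x \<Longrightarrow> half_space_gradient u x = 0"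
    and L: "\<And>x. x \<in> closed_half_space \<Longrightarrow> norm (half_space_gradient u x) \<le> L"
    using C1c_half_space_bounds[OF u] by metis
  show ?thesis
  proof (rule that)
    show "slope_average p u h \<le> ennreal (L powr p * (unit_ball_vol DIM(real ^ 'n) * R ^ DIM(real ^ 'n)))" for h
      unfolding slope_average_def
    proof (rule nn_integral_le_ball)
      fix x :: "real ^ 'n"
      have "directional_slope u x h powr p \<le> L powr p"
        using order_trans[OF directional_slope_le L[OF boundary_in_closed_half_space]] p
        by (intro powr_mono2) (auto simp: directional_slope_def)
      moreover have "directional_slope u x h powr p = 0" if "R \<le> norm x"
        using g0[OF boundary_in_closed_half_space, of x] that p by (simp add: directional_slope_def norm_Pair)
      ultimately show "ennreal (directional_slope u x h powr p) * indicator open_half_space h \<le> ennreal (L powr p) * indicator (ball 0 R) x"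
        by (auto simp: indicator_def intro: ennreal_leI)
    qed (use R in auto)
  qed (use R in simp)
qed

text \<open>
  The integrand vanishes unless one of the two points lies in the support of \<open>u\<close>. For each \<open>h\<close>, this
  confines \<open>x\<close> to two balls of fixed radius, so the average is bounded by a constant over \<open>\<bar>h\<bar>\<^sup>p\<close>
  although \<open>x\<close> ranges over the whole boundary.
\<close>

lemma difference_average_decay:
  fixes u :: "(real ^ 'n) \<times> real \<Rightarrow> real" and p :: real
  assumes u: "u \<in> C1c_closed_half_space" and p: "0 < p"
  obtains C where "0 \<le> C" "\<And>h. h \<noteq> 0 \<Longrightarrow> difference_average p u h \<le> ennreal (C * norm h powr - p)"
proof -
  obtain R U where R: "0 < R" "0 \<le> U"
    and u0: "\<And>x. x \<in> closed_half_space \<Longrightarrow> R \<le> norm x \<Longrightarrow> u x = 0"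
    and U: "\<And>x. x \<in> closed_half_space \<Longrightarrow> \<bar>u x\<bar> \<le> U"
    using C1c_half_space_bounds[OF u] by metis
  define V where "V = (\<lambda>r. unit_ball_vol CARD('n) * r ^ CARD('n))"
  have V: "0 < V r" if "0 < r" for r using that by (simp add: V_def)
  have [measurable]: "ball z r \<in> sets borel" for z :: "real ^ 'n" and r by simp
  have "difference_average p u h \<le> ennreal (2 * (2 * U) powr p * V R * norm h powr - p)" if h: "h \<noteq> 0" for h
  proof (cases "h \<in> open_half_space")
    case True
    let ?c = "(2 * U) powr p * norm h powr - p"
    have "difference_average p u h \<le> (\<integral>\<^sup>+x. ennreal ?c * indicator (ball 0 R) x + ennreal ?c * indicator (ball (- fst h) R) x \<partial>lborel)"
      unfolding difference_average_def
    proof (rule nn_integral_mono)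
      fix x :: "real ^ 'n"
      note x = boundary_in_closed_half_space[of x] boundary_plus_open_half_space[OF True, of x]
      have bound: "difference_quotient u x h powr p \<le> ?c"
      proof -
        have "difference_quotient u x h \<le> 2 * U / norm h"
          unfolding difference_quotient_def using U[OF x(1)] U[OF x(2)] by (intro divide_right_mono) auto
        then have "difference_quotient u x h powr p \<le> (2 * U / norm h) powr p"
          using p by (intro powr_mono2) (auto simp: difference_quotient_def)
        also have "\<dots> = ?c" using R h by (simp add: powr_divide powr_minus_divide)
        finally show ?thesis .
      qed
      have outside: "difference_quotient u x h powr p = 0" if "x \<notin> ball 0 R" "x \<notin> ball (- fst h) R"
      proof -
        have "norm (x + fst h) \<le> norm ((x, 0) + h)" using norm_fst_le[of "x + fst h" "snd h"] by (simp add: plus_prod_def)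
        moreover have "R \<le> norm (x + fst h)" using that(2) by (simp add: dist_norm norm_minus_commute add.commute)
        ultimately have "u ((x, 0) + h) = 0" using u0[OF x(2)] by simp
        moreover have "u (x, 0) = 0" using u0[OF x(1)] that(1) by (simp add: norm_Pair)
        ultimately show ?thesis using p by (simp add: difference_quotient_def)
      qed
      show "ennreal (difference_quotient u x h powr p) * indicator open_half_space h
         \<le> ennreal ?c * indicator (ball 0 R) x + ennreal ?c * indicator (ball (- fst h) R) x"
      proof (cases "x \<in> ball 0 R \<or> x \<in> ball (- fst h) R")
        case True
        have "ennreal (difference_quotient u x h powr p) * indicator open_half_space h \<le> ennreal ?c"
          using bound by (auto simp: indicator_def intro: ennreal_leI)
        also have "ennreal ?c \<le> ennreal ?c * indicator (ball 0 R) x + ennreal ?c * indicator (ball (- fst h) R) x"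
          using True by (auto simp: indicator_def)
        finally show ?thesis .
      qed (use outside in simp)
    qed
    also have "\<dots> = (\<integral>\<^sup>+x. ennreal ?c * indicator (ball (0 :: real ^ 'n) R) x \<partial>lborel) + (\<integral>\<^sup>+x. ennreal ?c * indicator (ball (- fst h) R) x \<partial>lborel)"
      by (rule nn_integral_add) measurable
    also have "\<dots> \<le> ennreal (?c * V R) + ennreal (?c * V R)"
    proof (rule add_mono)
      have *: "(\<integral>\<^sup>+x. ennreal ?c * indicator (ball z R) x \<partial>lborel) \<le> ennreal (?c * V R)" for z :: "real ^ 'n"
        using nn_integral_le_ball[OF order_refl, of R ?c z] R by (simp add: V_def)
      show "(\<integral>\<^sup>+x. ennreal ?c * indicator (ball (0 :: real ^ 'n) R) x \<partial>lborel) \<le> ennreal (?c * V R)"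
        "(\<integral>\<^sup>+x. ennreal ?c * indicator (ball (- fst h) R) x \<partial>lborel) \<le> ennreal (?c * V R)"
        by (rule *)+
    qed
    also have "\<dots> = ennreal (?c * V R + ?c * V R)"
      using V[OF R(1)] by (simp add: ennreal_plus[symmetric] del: ennreal_plus)
    also have "\<dots> = ennreal (2 * (2 * U) powr p * V R * norm h powr - p)"
      by (rule arg_cong[where f = ennreal]) simp
    finally show ?thesis .
  qed (simp add: difference_average_def)
  moreover have "0 \<le> 2 * (2 * U) powr p * V R" using V[OF R(1)] by simp
  ultimately show ?thesis using that by blast
qed

text \<open>
  If \<open>norm h < 1\<close>, both integrands vanish as soon as \<open>norm x \<ge> R + 1\<close>; hence a uniform error \<open>\<eta>\<close> of
  the integrands costs at most \<open>\<eta>\<close> times the volume of a ball.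
\<close>

lemma difference_average_near_slope_average:
  fixes u :: "(real ^ 'n) \<times> real \<Rightarrow> real" and p e :: real
  assumes u: "u \<in> C1c_closed_half_space" and p: "0 < p" and e: "0 < e"
  obtains \<delta> where "0 < \<delta>"
    "\<And>h. norm h < \<delta> \<Longrightarrow> difference_average p u h \<le> slope_average p u h + ennreal e
        \<and> slope_average p u h \<le> difference_average p u h + ennreal e"
proof -
  obtain R where R: "0 < R"
    and u0: "\<And>x. x \<in> closed_half_space \<Longrightarrow> R \<le> norm x \<Longrightarrow> u x = 0"
    and g0: "\<And>x. x \<in> closed_half_space \<Longrightarrow> R \<le> norm x \<Longrightarrow> half_space_gradient u x = 0"
    using C1c_half_space_bounds[OF u] by metis
  define V where "V = (\<lambda>r. unit_ball_vol CARD('n) * r ^ CARD('n))"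
  have V: "0 < V r" if "0 < r" for r using that by (simp add: V_def)
  have [measurable]: "ball z r \<in> sets borel" for z :: "real ^ 'n" and r by simp
  define \<eta> where "\<eta> = e / V (R + 1)"
  have \<eta>: "0 < \<eta>" "\<eta> * V (R + 1) = e" using e V[of "R + 1"] R by (simp_all add: \<eta>_def)
  obtain d where d: "0 < d" "\<And>x h. h \<in> open_half_space \<Longrightarrow> norm h < d \<Longrightarrow> \<bar>difference_quotient u x h powr p - directional_slope u x h powr p\<bar> \<le> \<eta>"
    using difference_quotient_tendsto_uniformly[OF u p \<eta>(1)] by blast
  show ?thesis
  proof (rule that)
    fix h :: "(real ^ 'n) \<times> real" assume h: "norm h < min d 1"
    let ?dq = "\<lambda>x. ennreal (difference_quotient u x h powr p) * indicator open_half_space h"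
    let ?ds = "\<lambda>x. ennreal (directional_slope u x h powr p) * indicator open_half_space h"
    let ?\<eta> = "\<lambda>x. ennreal \<eta> * indicator (ball (0 :: real ^ 'n) (R + 1)) x"
    have close: "?dq x \<le> ?ds x + ?\<eta> x \<and> ?ds x \<le> ?dq x + ?\<eta> x" for x
    proof (cases "h \<in> open_half_space")
      case True
      note x = boundary_in_closed_half_space[of x] boundary_plus_open_half_space[OF True, of x]
      show ?thesis
      proof (cases "x \<in> ball 0 (R + 1)")
        case True
        have "\<bar>difference_quotient u x h powr p - directional_slope u x h powr p\<bar> \<le> \<eta>"
          using d(2)[OF \<open>h \<in> open_half_space\<close>] h by simp
        then have "ennreal (difference_quotient u x h powr p) \<le> ennreal (directional_slope u x h powr p + \<eta>)"
          "ennreal (directional_slope u x h powr p) \<le> ennreal (difference_quotient u x h powr p + \<eta>)"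
          by - (rule ennreal_leI, linarith)+
        then show ?thesis using True \<open>h \<in> open_half_space\<close> \<eta> by simp
      next
        case False
        then have "R + 1 \<le> norm (x, 0::real)" by (simp add: norm_Pair)
        moreover have "norm (x, 0::real) \<le> norm ((x, 0) + h) + norm h"
          using norm_triangle_ineq4[of "(x, 0) + h" h] by simp
        ultimately have "u (x, 0) = 0" "u ((x, 0) + h) = 0" "half_space_gradient u (x, 0) = 0"
          using h by (auto intro!: u0 g0 x)
        then show ?thesis using p by (simp add: difference_quotient_def directional_slope_def)
      qed
    qed simp
    have [measurable]: "?dq \<in> borel_measurable borel" "?ds \<in> borel_measurable borel"
      using measurable_Pair1[OF borel_measurable_difference_quotient[OF u, of p], of h]
        measurable_Pair1[OF borel_measurable_directional_slope[OF u, of p], of h] by simp_all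
    have \<eta>_int: "(\<integral>\<^sup>+x. ?\<eta> x \<partial>(lborel :: (real ^ 'n) measure)) \<le> ennreal e"
      using nn_integral_le_ball[OF order_refl, of "R + 1" \<eta> "0 :: real ^ 'n"] R \<eta> by (simp add: V_def)
    have "difference_average p u h \<le> (\<integral>\<^sup>+x. ?ds x + ?\<eta> x \<partial>lborel)"
      unfolding difference_average_def using close by (intro nn_integral_mono) blast
    also have "\<dots> = slope_average p u h + (\<integral>\<^sup>+x. ?\<eta> x \<partial>lborel)"
      unfolding slope_average_def by (rule nn_integral_add) measurable
    also have "\<dots> \<le> slope_average p u h + ennreal e" by (intro add_left_mono \<eta>_int)
    finally have 1: "difference_average p u h \<le> slope_average p u h + ennreal e" .
    have "slope_average p u h \<le> (\<integral>\<^sup>+x. ?dq x + ?\<eta> x \<partial>lborel)"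
      unfolding slope_average_def using close by (intro nn_integral_mono) blast
    also have "\<dots> = difference_average p u h + (\<integral>\<^sup>+x. ?\<eta> x \<partial>lborel)"
      unfolding difference_average_def by (rule nn_integral_add) measurable
    also have "\<dots> \<le> difference_average p u h + ennreal e" by (intro add_left_mono \<eta>_int)
    finally have 2: "slope_average p u h \<le> difference_average p u h + ennreal e" .
    from 1 2 show "difference_average p u h \<le> slope_average p u h + ennreal e
        \<and> slope_average p u h \<le> difference_average p u h + ennreal e" ..
  qed (use d in simp)
qed

section \<open>The limit\<close>

lemma seminorm_eq_weighted_integral:
  fixes u :: "(real ^ 'n) \<times> real \<Rightarrow> real" and p s :: real
  assumes u: "u \<in> C1c_closed_half_space"
  shows "(\<integral>\<^sup>+ x. (\<integral>\<^sup>+ y\<in>open_half_space.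
            ennreal (\<bar>u (x, 0) - u y\<bar> powr p / norm ((x, 0) - y) powr (DIM((real ^ 'n) \<times> real) + s * p)) \<partial>lborel) \<partial>lborel)
       = (\<integral>\<^sup>+h. difference_average p u h * ennreal (norm h powr ((1 - s) * p - DIM((real ^ 'n) \<times> real))) \<partial>lborel)"
proof -
  let ?N = "real DIM((real ^ 'n) \<times> real)"
  let ?f = "\<lambda>x h. ennreal (difference_quotient u x h powr p) * indicator open_half_space h"
  let ?w = "\<lambda>h :: (real ^ 'n) \<times> real. ennreal (norm h powr ((1 - s) * p - ?N))"
  note [measurable] = borel_measurable_difference_quotient[OF u, of p]
  have f: "(\<lambda>(x, h). ?f x h) \<in> borel_measurable (lborel \<Otimes>\<^sub>M lborel)" by measurable
  have f1[measurable]: "(\<lambda>h. ?f x h) \<in> borel_measurable borel" for x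
    using measurable_Pair2[OF f, of x] by simp
  have f2[measurable]: "(\<lambda>x. ?f x h) \<in> borel_measurable borel" for h
    using measurable_Pair1[OF f, of h] by simp
  have "(\<integral>\<^sup>+ y\<in>open_half_space. ennreal (\<bar>u (x, 0) - u y\<bar> powr p / norm ((x, 0) - y) powr (?N + s * p)) \<partial>lborel)
      = (\<integral>\<^sup>+h. ?f x h * ?w h \<partial>lborel)" for x
  proof -
    have *: "ennreal (\<bar>u (x, 0) - u y\<bar> powr p / norm ((x, 0) - y) powr (?N + s * p)) * indicator open_half_space y
        = ?f x (y - (x, 0)) * ?w (y - (x, 0))" for y
    proof -
      define h where "h = y - (x, 0)"
      have y: "y = (x, 0) + h" by (simp add: h_def)
      have "\<bar>u (x, 0) - u y\<bar> powr p / norm h powr (?N + s * p)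
          = difference_quotient u x h powr p * norm h powr ((1 - s) * p - ?N)"
      proof (cases "h = 0")
        case False
        have "norm h powr ((1 - s) * p - ?N) = norm h powr p / norm h powr (?N + s * p)"
          by (simp add: powr_diff[symmetric] algebra_simps)
        then show ?thesis using False by (simp add: difference_quotient_def y powr_divide)
      qed (simp add: y)
      moreover have "norm ((x, 0) - y) = norm h" by (simp add: h_def norm_minus_commute)
      moreover have "indicator open_half_space y = (indicator open_half_space h :: ennreal)"
        by (auto simp: y indicator_def open_half_space_def mem_Times_iff)
      ultimately show ?thesis by (simp add: h_def[symmetric] ennreal_mult' mult_ac)
    qed
    have "(\<integral>\<^sup>+y. ?f x (y - (x, 0)) * ?w (y - (x, 0)) \<partial>lborel)
       = (\<integral>\<^sup>+y. ?f x (y - (x, 0)) * ?w (y - (x, 0)) \<partial>distr lborel borel ((+) (x, 0)))"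
      by (simp add: lborel_distr_plus)
    also have "\<dots> = (\<integral>\<^sup>+h. ?f x h * ?w h \<partial>lborel)"
      by (subst nn_integral_distr) auto
    finally show ?thesis by (simp only: *)
  qed
  then have "(\<integral>\<^sup>+ x. (\<integral>\<^sup>+ y\<in>open_half_space.
            ennreal (\<bar>u (x, 0) - u y\<bar> powr p / norm ((x, 0) - y) powr (?N + s * p)) \<partial>lborel) \<partial>lborel)
      = (\<integral>\<^sup>+x. \<integral>\<^sup>+h. ?f x h * ?w h \<partial>lborel \<partial>lborel)" by (simp only:)
  also have "\<dots> = (\<integral>\<^sup>+h. \<integral>\<^sup>+x. ?f x h * ?w h \<partial>lborel \<partial>lborel)"
    by (rule lborel_pair.Fubini'[symmetric]) measurable
  also have "\<dots> = (\<integral>\<^sup>+h. (\<integral>\<^sup>+x. ?f x h \<partial>lborel) * ?w h \<partial>lborel)"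
    by (intro nn_integral_cong nn_integral_multc) simp
  finally show ?thesis unfolding difference_average_def .
qed

text \<open>
  Exchanging the integrals once more leaves, for each \<open>x\<close>, the angular integral over the half-space
  for the vector \<open>Du(x, 0)\<close>; it is proportional to \<open>\<bar>Du(x, 0)\<bar>\<^sup>p\<close> with a factor that does not depend
  on \<open>x\<close>.
\<close>

lemma directional_slope_integral:
  fixes u :: "(real ^ 'n) \<times> real \<Rightarrow> real"
  assumes u: "u \<in> C1c_closed_half_space" and p: "0 < p" and N: "N = CARD('n) + 1"
  shows "ennreal (DIM((real ^ 'n) \<times> real) / p) *
      (\<integral>\<^sup>+h. slope_average p u h * indicator (ball 0 1) h \<partial>lborel)
    = ennreal (pi powr ((real N - 1) / 2) * Gamma ((p + 1) / 2) / (p * Gamma ((real N + p) / 2)))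
       * (\<integral>\<^sup>+ x. ennreal (norm (half_space_gradient u (x, 0)) powr p) \<partial>lborel)"
proof -
  let ?f = "\<lambda>x h. ennreal (directional_slope u x h powr p) * indicator open_half_space h"
  let ?D = "DIM((real ^ 'n) \<times> real)"
  define g where "g = (\<lambda>x. half_space_gradient u (x, 0))"
  define K where "K = sqrt pi ^ (?D - 1) * Gamma ((p + 1) / 2) / Gamma ((?D + p) / 2)"
  have D: "?D = N" using N by simp
  note [measurable] = borel_measurable_directional_slope[OF u, of p]
  have [measurable]: "ball (0 :: (real ^ 'n) \<times> real) 1 \<in> sets borel" by simp
  have f: "(\<lambda>(x, h). ?f x h) \<in> borel_measurable (lborel \<Otimes>\<^sub>M lborel)" by measurable
  have f1[measurable]: "(\<lambda>h. ?f x h) \<in> borel_measurable borel" for x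
    using measurable_Pair2[OF f, of x] by simp
  have f2[measurable]: "(\<lambda>x. ?f x h) \<in> borel_measurable borel" for h
    using measurable_Pair1[OF f, of h] by simp
  have g[measurable]: "g \<in> borel_measurable borel"
    unfolding g_def by (rule borel_measurable_boundary_gradient[OF u])
  have "0 \<le> K" unfolding K_def using p by (intro divide_nonneg_nonneg mult_nonneg_nonneg less_imp_le[OF Gamma_real_pos]) auto
  have "(\<integral>\<^sup>+h. (\<integral>\<^sup>+x. ?f x h \<partial>lborel) * indicator (ball 0 1) h \<partial>lborel)
      = (\<integral>\<^sup>+h. \<integral>\<^sup>+x. ?f x h * indicator (ball 0 1) h \<partial>lborel \<partial>lborel)"
    by (intro nn_integral_cong nn_integral_multc[symmetric]) simp
  also have "\<dots> = (\<integral>\<^sup>+x. \<integral>\<^sup>+h. ?f x h * indicator (ball 0 1) h \<partial>lborel \<partial>lborel)"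
    by (rule lborel_pair.Fubini') measurable
  finally have swap: "(\<integral>\<^sup>+h. (\<integral>\<^sup>+x. ?f x h \<partial>lborel) * indicator (ball 0 1) h \<partial>lborel)
      = (\<integral>\<^sup>+x. \<integral>\<^sup>+h. ?f x h * indicator (ball 0 1) h \<partial>lborel \<partial>lborel)" .
  have m[measurable]: "(\<lambda>x. \<integral>\<^sup>+h. ?f x h * indicator (ball 0 1) h \<partial>lborel) \<in> borel_measurable borel"
    by measurable
  have inner: "ennreal ?D * (\<integral>\<^sup>+h. ?f x h * indicator (ball 0 1) h \<partial>lborel) = ennreal K * ennreal (norm (g x) powr p)" for x
  proof -
    have "((0, 1) :: (real ^ 'n) \<times> real) \<noteq> 0" by (simp add: zero_prod_def)
    from nn_integral_angular_half_space[OF this p, of "g x"]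
    have "ennreal ?D * (\<integral>\<^sup>+h. ?f x h * indicator (ball 0 1) h \<partial>lborel) = ennreal (norm (g x) powr p * K)"
      unfolding directional_slope_def open_half_space_eq g_def K_def .
    then show ?thesis using \<open>0 \<le> K\<close> by (simp add: ennreal_mult' mult.commute)
  qed
  have "ennreal (?D / p) = ennreal (1 / p) * ennreal ?D"
    using p by (subst ennreal_mult'[symmetric]) auto
  then have "ennreal (?D / p) * (\<integral>\<^sup>+h. (\<integral>\<^sup>+x. ?f x h \<partial>lborel) * indicator (ball 0 1) h \<partial>lborel)
      = ennreal (1 / p) * (ennreal ?D * (\<integral>\<^sup>+x. \<integral>\<^sup>+h. ?f x h * indicator (ball 0 1) h \<partial>lborel \<partial>lborel))"
    by (simp only: swap mult.assoc)
  also have "ennreal ?D * (\<integral>\<^sup>+x. \<integral>\<^sup>+h. ?f x h * indicator (ball 0 1) h \<partial>lborel \<partial>lborel)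
      = (\<integral>\<^sup>+x. ennreal ?D * (\<integral>\<^sup>+h. ?f x h * indicator (ball 0 1) h \<partial>lborel) \<partial>lborel)"
    by (rule nn_integral_cmult[symmetric]) simp
  also have "\<dots> = ennreal K * (\<integral>\<^sup>+x. ennreal (norm (g x) powr p) \<partial>lborel)"
    unfolding inner by (rule nn_integral_cmult) simp
  also have "ennreal (1 / p) * (ennreal K * (\<integral>\<^sup>+x. ennreal (norm (g x) powr p) \<partial>lborel))
      = ennreal (1 / p * K) * (\<integral>\<^sup>+x. ennreal (norm (g x) powr p) \<partial>lborel)"
    using p by (subst ennreal_mult') (simp_all only: mult.assoc, simp)
  also have "1 / p * K = pi powr ((real N - 1) / 2) * Gamma ((p + 1) / 2) / (p * Gamma ((real N + p) / 2))"
  proof -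
    have "sqrt pi ^ (N - 1) = (pi powr (1 / 2)) powr real (N - 1)"
      by (simp add: powr_realpow powr_half_sqrt)
    also have "\<dots> = pi powr ((real N - 1) / 2)"
      using N by (simp add: powr_powr of_nat_diff)
    finally show ?thesis unfolding K_def D by simp
  qed
  finally show ?thesis unfolding g_def slope_average_def .
qed

theorem theorem8p1:
  fixes u :: "(real ^ 'n) \<times> real \<Rightarrow> real" and p :: real and N :: nat
  assumes "N = CARD('n) + 1"
    and "1 \<le> p"
    and "u \<in> C1c_closed_half_space"
  shows "((\<lambda>s::real. ennreal (1 - s) *
            (\<integral>\<^sup>+ x. (\<integral>\<^sup>+ y\<in>open_half_space.
                ennreal (\<bar>u (x, 0) - u y\<bar> powr p / norm ((x, 0) - y) powr (real N + s * p))
              \<partial>lborel) \<partial>lborel))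
          \<longlongrightarrow> ennreal (pi powr ((real N - 1) / 2) * Gamma ((p + 1) / 2)
                / (p * Gamma ((real N + p) / 2)))
              * (\<integral>\<^sup>+ x. ennreal (norm (half_space_gradient u (x, 0)) powr p) \<partial>lborel))
         (at_left 1)"
proof -
  note u = assms(3)
  have p: "0 < p" using assms(2) by simp
  let ?D = "DIM((real ^ 'n) \<times> real)"
  have D: "real N = real ?D" using assms(1) by simp
  obtain C1 where C1: "0 \<le> C1" "\<And>h. slope_average p u h \<le> ennreal C1"
    using slope_average_bounded[OF u p] by blast
  obtain C2 where C2: "0 \<le> C2" "\<And>h. h \<noteq> 0 \<Longrightarrow> difference_average p u h \<le> ennreal (C2 * norm h powr - p)"
    using difference_average_decay[OF u p] by blast
  have "((\<lambda>s. ennreal (1 - s) * (\<integral>\<^sup>+h. difference_average p u h * ennreal (norm h powr ((1 - s) * p - ?D)) \<partial>lborel))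
     \<longlongrightarrow> ennreal (?D / p) * (\<integral>\<^sup>+h. slope_average p u h * indicator (ball 0 1) h \<partial>lborel)) (at_left 1)"
  proof (rule concentration_at_zero[OF borel_measurable_averages[OF u] p])
    show "0 \<le> max C1 C2" using C1 by simp
    show "slope_average p u h \<le> ennreal (max C1 C2)" for h
      by (rule order_trans[OF C1(2) ennreal_leI]) simp
    show "difference_average p u h \<le> ennreal (max C1 C2 * norm h powr - p)" if "h \<noteq> 0" for h
      by (rule order_trans[OF C2(2)[OF that] ennreal_leI]) (simp add: mult_right_mono)
    show "\<exists>\<delta>>0. \<forall>h. h \<noteq> 0 \<longrightarrow> norm h < \<delta> \<longrightarrow> difference_average p u h \<le> slope_average p u h + ennreal e
        \<and> slope_average p u h \<le> difference_average p u h + ennreal e" if "0 < e" for e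
      using difference_average_near_slope_average[OF u p that] by metis
  qed (rule slope_average_scaleR)
  then show ?thesis
    unfolding seminorm_eq_weighted_integral[OF u, symmetric]
      directional_slope_integral[OF u p assms(1)]
    unfolding D[symmetric] .
qed

end
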